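(* Let $G$ be a graph with maximum degree $\Delta(G)\geq 8$ and maximum average degree ${\rm mad}(G)<\frac{14}{3}$. Then $\chi''_\Sigma(G)\leq \Delta(G)+3$.
   Context: Graphs are finite and simple. A proper total $k$-colouring of a graph $G=(V,E)$ is a map $c:V\cup E\to\{1,2,\ldots,k\}$ such that adjacent vertices receive distinct colours, adjacent edges (edges sharing an end-vertex) receive distinct colours, and every edge receives a colour distinct from the colours of both its end-vertices. For such $c$ and $w\in V$, let $s(w)=c(w)+\sum_{e\ni w}c(e)$, the sum over edges incident with $w$. A total neighbour sum distinguishing $k$-colouring (tnsd $k$-colouring) is a proper total $k$-colouring with $s(u)\neq s(v)$ for every edge $uv\in E$. The total neighbour sum distinguishing index $\chi''_\Sigma(G)$ is the least $k$ for which $G$ admits a tnsd $k$-colouring. The maximum average degree is ${\rm mad}(G)=\max\{2|E(H)|/|V(H)| : H\subseteq G\}$. *)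

theory Defs
  imports Complex_Main
begin

definition simple_graph :: "'a set \<Rightarrow> 'a set set \<Rightarrow> bool" where
  "simple_graph V E \<longleftrightarrow> finite V \<and> (\<forall>e\<in>E. e \<subseteq> V \<and> card e = 2)"

definition incident_edges :: "'a set set \<Rightarrow> 'a \<Rightarrow> 'a set set" where
  "incident_edges E v = {e \<in> E. v \<in> e}"

definition degree :: "'a set set \<Rightarrow> 'a \<Rightarrow> nat" where
  "degree E v = card (incident_edges E v)"

text \<open>Maximum degree (0 for the empty graph).\<close>
definition max_degree :: "'a set \<Rightarrow> 'a set set \<Rightarrow> nat" where
  "max_degree V E = Max (insert 0 (degree E ` V))"

definition mad :: "'a set \<Rightarrow> 'a set set \<Rightarrow> real" where
  "mad V E = Max (insert 0 {2 * real (card E') / real (card V') | V' E'.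
       V' \<subseteq> V \<and> V' \<noteq> {} \<and> E' \<subseteq> E \<and> (\<forall>e\<in>E'. e \<subseteq> V')})"

definition proper_total_colouring ::
  "'a set \<Rightarrow> 'a set set \<Rightarrow> nat \<Rightarrow> ('a \<Rightarrow> nat) \<Rightarrow> ('a set \<Rightarrow> nat) \<Rightarrow> bool" where
  "proper_total_colouring V E k f g \<longleftrightarrow>
     (\<forall>v\<in>V. f v \<in> {1..k}) \<and> (\<forall>e\<in>E. g e \<in> {1..k}) \<and>
     (\<forall>u\<in>V. \<forall>v\<in>V. {u, v} \<in> E \<longrightarrow> f u \<noteq> f v) \<and>
     (\<forall>e1\<in>E. \<forall>e2\<in>E. e1 \<noteq> e2 \<and> e1 \<inter> e2 \<noteq> {} \<longrightarrow> g e1 \<noteq> g e2) \<and>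
     (\<forall>e\<in>E. \<forall>v\<in>e. g e \<noteq> f v)"

definition colour_sum :: "'a set set \<Rightarrow> ('a \<Rightarrow> nat) \<Rightarrow> ('a set \<Rightarrow> nat) \<Rightarrow> 'a \<Rightarrow> nat" where
  "colour_sum E f g w = f w + (\<Sum>e\<in>incident_edges E w. g e)"

definition tnsd_colouring ::
  "'a set \<Rightarrow> 'a set set \<Rightarrow> nat \<Rightarrow> ('a \<Rightarrow> nat) \<Rightarrow> ('a set \<Rightarrow> nat) \<Rightarrow> bool" where
  "tnsd_colouring V E k f g \<longleftrightarrow> proper_total_colouring V E k f g \<and>
     (\<forall>u\<in>V. \<forall>v\<in>V. {u, v} \<in> E \<longrightarrow> colour_sum E f g u \<noteq> colour_sum E f g v)"

definition tnsd_index :: "'a set \<Rightarrow> 'a set set \<Rightarrow> nat" where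
  "tnsd_index V E = (LEAST k. \<exists>f g. tnsd_colouring V E k f g)"

end

theory Submission
  imports Defs
begin

text \<open>
  Let \<open>k = \<Delta> + 3\<close> and take a counterexample with fewest edges. A vertex of degree at most 3 can always
  be coloured last, since it has at most \<open>9 < k\<close> forbidden colours; so these small vertices stay
  uncoloured and impose no sum condition. Deleting a star of edges at a vertex \<open>v\<close>, colouring the
  rest and recolouring the star excludes a number of configurations. If all leaves of the star are
  small, the new edges need distinct representatives of their colour lists whose sum avoids the
  sums at the other neighbours of \<open>v\<close>, and \<open>n\<close> lists with \<open>e\<close> spare colours realise at least
  \<open>n e + 1\<close> different sums. If some leaves have degree 4, these are recoloured as well, and the
  Combinatorial Nullstellensatz is applied to a product of linear forms in at most five variables.

  The excluded configurations contradict \<open>mad < 14/3\<close>: after removing the vertices of degree at most 2,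
  every vertex of degree 3 receives 5/9 and every vertex of degree 4 receives 1/6 from each neighbour,
  and then every vertex has charge at least 14/3.
\<close>

section \<open>Nullstellensatz for products of affine forms\<close>

text \<open>Deleting edges may lower the maximum degree, so the induction fixes \<open>k\<close> and
  asks only that it exceed every degree by at least 3. Let \<open>v\<close> have degree
  \<open>d\<close> and \<open>t\<close> neighbours of degree at most 3, and let
  \<open>k \<ge> d + 3 + j\<close>. After the star to these leaves is deleted, an edge of it sees at
  most \<open>d - t\<close> colours at \<open>v\<close> and 2 at its leaf, so
  \<open>t + 1 + j\<close> colours remain. If \<open>v\<close> keeps its colour, this is surplus
  \<open>j\<close>, and \<open>t j\<close> sums can be avoided. The obstacle is a vertex of maximum
  degree, where possibly \<open>j = 0\<close>. One more unit of surplus then has to be found: by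
  choosing the colour of \<open>v\<close> together with the edges, or from a leaf of degree at most
  2, which forbids one colour less. A leaf of degree 4 cannot be left uncoloured, since 12 colours
  may be forbidden there while \<open>k\<close> may be 11; its own sum adds conditions that go
  beyond the sum at \<open>v\<close>. The shares 5/9 and 1/6 are the deficits 14/3 - 3 and 14/3 - 4
  divided equally among 3 and 4 neighbours.\<close>

text \<open>An iterated divided difference over a grid. Multiplying by \<open>x\<^sub>i - a\<close> removes \<open>a\<close> from the \<open>i\<close>-th side
  of the grid, so on a product of \<open>\<Sum>\<^sub>i (|A\<^sub>i| - 1)\<close> affine forms the functional reads off the coefficient
  of \<open>\<Prod>\<^sub>i x\<^sub>i^(|A\<^sub>i| - 1)\<close>. This yields the Combinatorial Nullstellensatz for such products.\<close>

definition dd_weight :: "real set \<Rightarrow> real \<Rightarrow> real" where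
  "dd_weight A a = inverse (\<Prod>b\<in>A - {a}. a - b)"

fun grid_dd :: "real set list \<Rightarrow> (real list \<Rightarrow> real) \<Rightarrow> real" where
  "grid_dd [] F = F []"
| "grid_dd (A # As) F = (\<Sum>a\<in>A. dd_weight A a * grid_dd As (\<lambda>xs. F (a # xs)))"

lemma dd_mult_diff:
  assumes "finite A" "a \<in> A"
  shows "(\<Sum>b\<in>A. dd_weight A b * ((b - a) * h b)) = (\<Sum>b\<in>A - {a}. dd_weight (A - {a}) b * h b)"
proof -
  have "(\<Sum>b\<in>A. dd_weight A b * ((b - a) * h b)) = (\<Sum>b\<in>A - {a}. dd_weight A b * ((b - a) * h b))"
    using assms by (subst sum.remove[of _ a]) auto
  also have "\<dots> = (\<Sum>b\<in>A - {a}. dd_weight (A - {a}) b * h b)"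
  proof (rule sum.cong[OF refl])
    fix b assume b: "b \<in> A - {a}"
    have "A - {b} = insert a (A - {a} - {b})" using assms b by auto
    then have "(\<Prod>c\<in>A - {b}. b - c) = (b - a) * (\<Prod>c\<in>A - {a} - {b}. b - c)"
      using assms by simp
    then show "dd_weight A b * ((b - a) * h b) = dd_weight (A - {a}) b * h b"
      using b by (simp add: dd_weight_def)
  qed
  finally show ?thesis .
qed

lemma grid_dd_add: "grid_dd As (\<lambda>xs. F xs + G xs) = grid_dd As F + grid_dd As G"
  by (induction As arbitrary: F G) (simp_all add: sum.distrib distrib_left)

lemma grid_dd_cmult: "grid_dd As (\<lambda>xs. c * F xs) = c * grid_dd As F"
  by (induction As arbitrary: F) (simp_all add: sum_distrib_left mult.left_commute)

lemma grid_dd_sum: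
  "finite I \<Longrightarrow> grid_dd As (\<lambda>xs. \<Sum>i\<in>I. F i xs) = (\<Sum>i\<in>I. grid_dd As (F i))"
proof (induction I rule: finite_induct)
  case empty
  have "grid_dd As (\<lambda>xs. 0) = 0" using grid_dd_cmult[of As 0 "\<lambda>_. 0"] by simp
  then show ?case by simp
qed (simp add: grid_dd_add)

lemma grid_dd_mult_diff:
  assumes "i < length As" "finite (As ! i)" "a \<in> As ! i"
  shows "grid_dd As (\<lambda>xs. (xs ! i - a) * F xs) = grid_dd (As[i := As ! i - {a}]) F"
  using assms
proof (induction As arbitrary: F i)
  case (Cons A As)
  show ?case
  proof (cases i)
    case 0
    then show ?thesis using Cons.prems dd_mult_diff[of A a "\<lambda>b. grid_dd As (\<lambda>xs. F (b # xs))"]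
      by (simp add: grid_dd_cmult)
  next
    case (Suc j)
    then show ?thesis using Cons.prems Cons.IH[of j] by simp
  qed
qed simp

text \<open>A side with a single point becomes empty when that point is removed, so the terms in
  which an exponent would drop below 0 vanish.\<close>

lemma grid_dd_empty: "{} \<in> set As \<Longrightarrow> grid_dd As F = 0"
  by (induction As arbitrary: F) auto

lemma grid_dd_cong:
  assumes "\<And>xs. list_all2 (\<in>) xs As \<Longrightarrow> F xs = G xs"
  shows "grid_dd As F = grid_dd As G"
  using assms
proof (induction As arbitrary: F G)
  case (Cons A As)
  show ?case
    by (simp, intro sum.cong refl arg_cong2[where f = "(*)"] Cons.IH) (simp add: Cons.prems)
qed simp

text \<open>Writing \<open>x_i = (x_i - a_i) + a_i\<close> with one grid point \<open>a_i\<close>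
  per side turns an affine factor into removals of points plus a constant multiple on the unchanged
  grid.\<close>

lemma grid_dd_mult_linear:
  fixes l :: "real list"
  assumes len: "length As = n" "length as = n"
    and fin: "\<And>i. i < n \<Longrightarrow> finite (As ! i)" and mem: "\<And>i. i < n \<Longrightarrow> as ! i \<in> As ! i"
  shows "grid_dd As (\<lambda>xs. ((\<Sum>i<n. l ! i * xs ! i) + c) * F xs) =
    (\<Sum>i<n. l ! i * grid_dd (As[i := As ! i - {as ! i}]) F) + (c + (\<Sum>i<n. l ! i * as ! i)) * grid_dd As F"
proof -
  have "grid_dd As (\<lambda>xs. ((\<Sum>i<n. l ! i * xs ! i) + c) * F xs) =
    grid_dd As (\<lambda>xs. (\<Sum>i<n. l ! i * ((xs ! i - as ! i) * F xs)) + (c + (\<Sum>i<n. l ! i * as ! i)) * F xs)"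
    by (rule arg_cong[where f = "grid_dd As"])
      (simp add: fun_eq_iff algebra_simps sum_subtractf sum_distrib_left sum_distrib_right)
  also have "\<dots> = (\<Sum>i<n. l ! i * grid_dd (As[i := As ! i - {as ! i}]) F)
      + (c + (\<Sum>i<n. l ! i * as ! i)) * grid_dd As F"
    using len fin mem by (simp add: grid_dd_add grid_dd_sum grid_dd_cmult grid_dd_mult_diff)
  finally show ?thesis .
qed

text \<open>The coefficient of the monomial with exponent vector \<open>t\<close> in the product of
  the linear forms \<open>ls\<close>. The index \<open>i\<close> names the variable taken from the
  first form, whose exponent therefore drops by one.\<close>

fun lin_coeff :: "int list list \<Rightarrow> nat list \<Rightarrow> int" where
  "lin_coeff [] t = (if \<forall>i<length t. t ! i = 0 then 1 else 0)"
| "lin_coeff (l # ls) t = (\<Sum>i<length t. if t ! i = 0 then 0 else l ! i * lin_coeff ls (t[i := t ! i - 1]))"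

definition lin_form :: "nat \<Rightarrow> int list \<Rightarrow> real \<Rightarrow> real list \<Rightarrow> real" where
  "lin_form n l c xs = (\<Sum>i<n. of_int (l ! i) * xs ! i) + c"

text \<open>By induction on the total size, removing a point leaves a value that depends on the
  sizes only. Hence the factors \<open>x_i - a\<close> and \<open>x_i - a'\<close> give the same
  value, while their difference is the nonzero constant \<open>a' - a\<close>.\<close>

lemma grid_dd_const:
  assumes "\<And>i. i < length As \<Longrightarrow> finite (As ! i) \<and> As ! i \<noteq> {}"
  shows "grid_dd As (\<lambda>_. 1) = (if \<forall>i<length As. card (As ! i) = 1 then 1 else 0)"
  using assms
proof (induction "\<Sum>A\<leftarrow>As. card A" arbitrary: As rule: less_induct)
  case less
  show ?case
  proof (cases "\<forall>i<length As. card (As ! i) = 1")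
    case True
    then have "grid_dd As (\<lambda>_. 1) = 1" 
    proof (induction As)
      case (Cons A As)
      then have "card A = 1" by auto
      then obtain a where "A = {a}" by (rule card_1_singletonE)
      moreover have "\<forall>i<length As. card (As ! i) = 1" using Cons.prems by fastforce
      then have "grid_dd As (\<lambda>_. 1) = 1" by (rule Cons.IH)
      ultimately show ?case by (simp add: dd_weight_def)
    qed simp
    then show ?thesis using True by simp
  next
    case False
    then obtain i where i: "i < length As" "card (As ! i) \<noteq> 1" by auto
    have fi: "finite (As ! i)" "As ! i \<noteq> {}" using less.prems i by auto
    with i obtain a a' where a: "a \<in> As ! i" "a' \<in> As ! i" "a \<noteq> a'"
      by (metis card_1_singleton_iff is_singletonI' is_singleton_def One_nat_def)
    have *: "grid_dd (As[i := As ! i - {b}]) (\<lambda>_. 1) =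
       (if (\<forall>j<length As. j \<noteq> i \<longrightarrow> card (As ! j) = 1) \<and> card (As ! i) = 2 then 1 else 0)"
      if b: "b \<in> {a, a'}" for b
    proof -
      have ne: "As ! i - {b} \<noteq> {}" using a b by auto
      have c: "card (As ! i - {b}) < card (As ! i)" using a b fi
        by (metis card_Diff1_less insertE singletonD)
      have lt: "(\<Sum>A\<leftarrow>As[i := As ! i - {b}]. card A) < (\<Sum>A\<leftarrow>As. card A)"
      proof -
        have "(\<Sum>A\<leftarrow>As[i := As ! i - {b}]. card A) + card (As ! i) = (\<Sum>A\<leftarrow>As. card A) + card (As ! i - {b})"
          using i(1) by (induction As arbitrary: i) (auto split: nat.splits simp: nth_Cons')
        then show ?thesis using c by linarith
      qed
      have fb: "card (As ! i - {b}) = 1 \<longleftrightarrow> card (As ! i) = 2"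
        using a b fi by (auto simp: card_Diff_singleton_if)
      have "grid_dd (As[i := As ! i - {b}]) (\<lambda>_. 1) = 
         (if \<forall>j<length (As[i := As ! i - {b}]). card (As[i := As ! i - {b}] ! j) = 1 then 1 else 0)"
      proof (rule less.hyps[OF lt])
        fix j assume "j < length (As[i := As ! i - {b}])"
        then show "finite (As[i := As ! i - {b}] ! j) \<and> As[i := As ! i - {b}] ! j \<noteq> {}"
          using less.prems ne fi i(1) by (cases "j = i") auto
      qed
      also have "(\<forall>j<length (As[i := As ! i - {b}]). card (As[i := As ! i - {b}] ! j) = 1)
         \<longleftrightarrow> (\<forall>j<length As. j \<noteq> i \<longrightarrow> card (As ! j) = 1) \<and> card (As ! i) = 2"
        using fb i(1) by (auto simp: nth_list_update split: if_splits)
      finally show ?thesis .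
    qed
    have "(a' - a) * grid_dd As (\<lambda>_. 1) =
      grid_dd As (\<lambda>xs. (xs ! i - a) * 1 + (- 1) * ((xs ! i - a') * 1))"
      using grid_dd_cmult[of As "a' - a" "\<lambda>_. 1"] by (simp add: algebra_simps)
    also have "\<dots> = grid_dd As (\<lambda>xs. (xs ! i - a) * 1) + (- 1) * grid_dd As (\<lambda>xs. (xs ! i - a') * 1)"
      by (simp only: grid_dd_add grid_dd_cmult)
    also have "\<dots> = 0"
      using * a by (simp only: grid_dd_mult_diff[OF i(1) fi(1) a(1)] grid_dd_mult_diff[OF i(1) fi(1) a(2)]) auto
    finally show ?thesis using a False by auto
  qed
qed

lemma sum_list_update_pred:
  fixes t :: "nat list"
  assumes "i < length t" "t ! i \<noteq> 0"
  shows "sum_list (t[i := t ! i - 1]) + 1 = sum_list t"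
  using assms by (induction t arbitrary: i) (auto split: nat.splits simp: nth_Cons')

text \<open>The inequality admits products of too small degree, on which the functional vanishes.
  The induction needs this case: it removes the constant left over from each affine factor, so that
  only the leading coefficient survives.\<close>

lemma grid_dd_linear_product:
  assumes "length As = length t" "\<And>i. i < length t \<Longrightarrow> finite (As ! i) \<and> card (As ! i) = t ! i + 1"
    and "length ls \<le> sum_list t"
  shows "grid_dd As (\<lambda>xs. \<Prod>(l, c)\<leftarrow>ls. lin_form (length t) l c xs) =
    (if length ls = sum_list t then of_int (lin_coeff (map fst ls) t) else 0)"
  using assms
proof (induction ls arbitrary: As t)
  case Nil
  have ne: "i < length As \<Longrightarrow> finite (As ! i) \<and> As ! i \<noteq> {}" for i
    using Nil by (metis add.commute card.empty nat.simps(3) plus_1_eq_Suc)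
  have "(0 = sum_list t) \<longleftrightarrow> (\<forall>i<length t. t ! i = 0)"
    by (metis in_set_conv_nth sum_list_eq_0_iff)
  then show ?case using grid_dd_const[of As, OF ne] Nil by auto
next
  case (Cons lc ls)
  obtain l c where lc: "lc = (l, c)" by force
  let ?n = "length t"
  let ?F = "\<lambda>xs. \<Prod>(l, c)\<leftarrow>ls. lin_form ?n l c xs"
  have fin: "finite (As ! i)" if "i < ?n" for i using Cons.prems that by auto
  have "\<exists>a. a \<in> As ! i" if "i < ?n" for i using Cons.prems(2)[OF that]
    by (metis add_is_0 card.empty ex_in_conv one_neq_zero)
  then have "\<exists>as. length as = ?n \<and> (\<forall>i<?n. as ! i \<in> As ! i)"
    by (intro Skolem_list_nth[THEN iffD1]) auto
  then obtain as where as: "length as = ?n" "\<And>i. i < ?n \<Longrightarrow> as ! i \<in> As ! i" by auto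
  have F0: "grid_dd As ?F = 0"
    using Cons.IH[of As t] Cons.prems by auto
  have Fi: "grid_dd (As[i := As ! i - {as ! i}]) ?F =
     (if t ! i = 0 \<or> length (lc # ls) \<noteq> sum_list t then 0 else of_int (lin_coeff (map fst ls) (t[i := t ! i - 1])))"
    if i: "i < ?n" for i
  proof (cases "t ! i = 0")
    case True
    then have "card (As ! i) = 1" using Cons.prems i by auto
    then have "As ! i - {as ! i} = {}" using as(2)[OF i] by (metis card_1_singletonE Diff_cancel singletonD)
    then have "{} \<in> set (As[i := As ! i - {as ! i}])"
      using i Cons.prems(1) by (metis set_update_memI)
    then show ?thesis using True grid_dd_empty by auto
  next
    case False
    let ?t = "t[i := t ! i - 1]"
    have s: "sum_list ?t + 1 = sum_list t" by (rule sum_list_update_pred[OF i False])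
    have "grid_dd (As[i := As ! i - {as ! i}]) (\<lambda>xs. \<Prod>(l, c)\<leftarrow>ls. lin_form (length ?t) l c xs) =
      (if length ls = sum_list ?t then of_int (lin_coeff (map fst ls) ?t) else 0)"
    proof (rule Cons.IH)
      show "finite (As[i := As ! i - {as ! i}] ! j) \<and> card (As[i := As ! i - {as ! i}] ! j) = ?t ! j + 1"
        if "j < length ?t" for j
        using that Cons.prems(1,2) as i False by (auto simp: nth_list_update card_Diff_singleton)
    qed (use Cons.prems s in auto)
    then show ?thesis using False s by (auto simp: case_prod_beta)
  qed
  have "grid_dd As (\<lambda>xs. \<Prod>(l, c)\<leftarrow>lc # ls. lin_form ?n l c xs) =
    grid_dd As (\<lambda>xs. ((\<Sum>i<?n. map (\<lambda>i. of_int (l ! i)) [0..<?n] ! i * xs ! i) + c) * ?F xs)"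
    using lc by (intro arg_cong[where f = "grid_dd As"]) (auto simp: fun_eq_iff lin_form_def)
  also have "\<dots> = (\<Sum>i<?n. map (\<lambda>i. of_int (l ! i)) [0..<?n] ! i * grid_dd (As[i := As ! i - {as ! i}]) ?F)"
    using grid_dd_mult_linear[of As ?n as "map (\<lambda>i. of_int (l ! i)) [0..<?n]" c ?F] Cons.prems as fin F0 by simp
  also have "\<dots> = (\<Sum>i<?n. if t ! i = 0 \<or> length (lc # ls) \<noteq> sum_list t then 0 else of_int (l ! i * lin_coeff (map fst ls) (t[i := t ! i - 1])))"
    by (intro sum.cong refl) (use Fi in auto)
  also have "\<dots> = (if length (lc # ls) = sum_list t then of_int (lin_coeff (map fst (lc # ls)) t) else 0)"
    using lc by (auto simp: of_int_sum intro!: sum.cong)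
  finally show ?case .
qed

text \<open>The sides are cut down to exactly \<open>t ! i + 1\<close> points. If the product
  vanished on this whole grid, the functional would be 0 instead of the given coefficient.\<close>

theorem linear_nullstellensatz:
  assumes "lin_coeff (map fst ls) t \<noteq> 0" "length ls = sum_list t" "length As = length t"
    and "\<And>i. i < length t \<Longrightarrow> finite (As ! i) \<and> t ! i < card (As ! i)"
  obtains xs where "length xs = length t" "\<And>i. i < length t \<Longrightarrow> xs ! i \<in> As ! i"
    "\<And>l c. (l, c) \<in> set ls \<Longrightarrow> lin_form (length t) l c xs \<noteq> 0"
proof -
  have "\<exists>B. B \<subseteq> As ! i \<and> card B = t ! i + 1 \<and> finite B" if "i < length t" for i
    using assms(4)[OF that] by (metis Suc_eq_plus1 Suc_leI finite_subset obtain_subset_with_card_n)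
  then have "\<exists>Bs. length Bs = length t \<and> (\<forall>i<length t. Bs ! i \<subseteq> As ! i \<and> card (Bs ! i) = t ! i + 1 \<and> finite (Bs ! i))"
    by (intro Skolem_list_nth[THEN iffD1]) auto
  then obtain Bs where Bs: "length Bs = length t"
    "\<And>i. i < length t \<Longrightarrow> Bs ! i \<subseteq> As ! i \<and> card (Bs ! i) = t ! i + 1 \<and> finite (Bs ! i)" by auto
  let ?P = "\<lambda>xs. \<Prod>(l, c)\<leftarrow>ls. lin_form (length t) l c xs"
  have "grid_dd Bs ?P \<noteq> 0"
    using grid_dd_linear_product[of Bs t ls] Bs assms by auto
  then obtain xs where xs: "list_all2 (\<in>) xs Bs" "?P xs \<noteq> 0"
    using grid_dd_cong[of Bs ?P "\<lambda>_. 0"] grid_dd_cmult[of Bs 0 ?P] by fastforce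
  show thesis
  proof (rule that)
    show "length xs = length t" using xs(1) Bs(1) by (auto dest: list_all2_lengthD)
    show "xs ! i \<in> As ! i" if "i < length t" for i
      using xs(1) Bs(1) Bs(2)[OF that] that by (auto simp: list_all2_conv_all_nth)
    show "lin_form (length t) l c xs \<noteq> 0" if "(l, c) \<in> set ls" for l c
      using xs(2) that by (force simp: prod_list_zero_iff)
  qed
qed

text \<open>The recursion of \<open>lin_coeff\<close> branches exponentially. Here it runs breadth first on a list of weighted
  exponent vectors in which equal vectors are merged, which makes it feasible by rewriting.\<close>

fun add_term :: "int \<Rightarrow> nat list \<Rightarrow> (int \<times> nat list) list \<Rightarrow> (int \<times> nat list) list" where
  "add_term c t [] = [(c, t)]"
| "add_term c t ((d, s) # ps) = (if s = t then (c + d, s) # ps else (d, s) # add_term c t ps)"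

text \<open>\<open>us\<close> collects the exponents already passed, so that each lowered vector can
  be rebuilt in full. Variables with coefficient 0 or exponent 0 produce no term.\<close>

fun lower :: "int \<Rightarrow> int list \<Rightarrow> nat list \<Rightarrow> nat list \<Rightarrow> (int \<times> nat list) list \<Rightarrow> (int \<times> nat list) list" where
  "lower c l us [] ps = ps"
| "lower c [] us (t # ts) ps = ps"
| "lower c (l # ls) us (t # ts) ps =
    (if t = 0 \<or> l = 0 then lower c ls (us @ [t]) ts ps
     else lower c ls (us @ [t]) ts (add_term (c * l) (us @ (t - 1) # ts) ps))"

fun lower_all :: "int list \<Rightarrow> (int \<times> nat list) list \<Rightarrow> (int \<times> nat list) list \<Rightarrow> (int \<times> nat list) list" where
  "lower_all l [] ps = ps"
| "lower_all l ((c, t) # qs) ps = lower_all l qs (lower c l [] t ps)"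

fun coeff_run :: "int list list \<Rightarrow> (int \<times> nat list) list \<Rightarrow> int" where
  "coeff_run [] ps = (\<Sum>(c, t)\<leftarrow>ps. if list_all (\<lambda>n. n = 0) t then c else 0)"
| "coeff_run (l # ls) ps = coeff_run ls (lower_all l ps [])"

text \<open>The invariant of the run: the weighted exponent vectors stand for a combination of
  coefficients with respect to the forms still to be processed.\<close>

abbreviation state_value :: "int list list \<Rightarrow> (int \<times> nat list) list \<Rightarrow> int" where
  "state_value ls ps \<equiv> (\<Sum>(c, t)\<leftarrow>ps. c * lin_coeff ls t)"

lemma state_value_add_term: "state_value ls (add_term c t ps) = c * lin_coeff ls t + state_value ls ps"
  by (induction c t ps rule: add_term.induct) (auto simp: algebra_simps)

lemma state_value_lower:
  assumes "length l = length t"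
  shows "state_value ls (lower c l us t ps) = state_value ls ps +
    c * (\<Sum>i<length t. if t ! i = 0 then 0 else l ! i * lin_coeff ls (us @ t[i := t ! i - 1]))"
  using assms
proof (induction l t arbitrary: us ps rule: list_induct2)
  case (Cons x xs y ys)
  have "(\<Sum>i<length (y # ys). if (y # ys) ! i = 0 then 0
      else (x # xs) ! i * lin_coeff ls (us @ (y # ys)[i := (y # ys) ! i - 1])) =
    (if y = 0 then 0 else x * lin_coeff ls (us @ (y - 1) # ys)) +
    (\<Sum>i<length ys. if ys ! i = 0 then 0 else xs ! i * lin_coeff ls ((us @ [y]) @ ys[i := ys ! i - 1]))"
    by (simp del: sum.lessThan_Suc add: sum.lessThan_Suc_shift cong: if_cong)
  then show ?case by (simp only: lower.simps Cons.IH state_value_add_term algebra_simps split: if_split) (auto simp: algebra_simps)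
qed simp

lemma state_value_lower_all:
  assumes "\<forall>(c, t)\<in>set qs. length t = length l"
  shows "state_value ls (lower_all l qs ps) = state_value ls ps + state_value (l # ls) qs"
  using assms
  by (induction l qs ps rule: lower_all.induct) (auto simp: state_value_lower cong: if_cong)

lemma add_term_length:
  "\<forall>(c, t)\<in>set ps. length t = n \<Longrightarrow> length t = n \<Longrightarrow> \<forall>(c, t)\<in>set (add_term c t ps). length t = n"
  by (induction c t ps rule: add_term.induct) auto

lemma lower_length:
  "\<forall>(c, t)\<in>set ps. length t = n \<Longrightarrow> length us + length t = n \<Longrightarrow>
    \<forall>(c, t)\<in>set (lower c l us t ps). length t = n"
proof (induction c l us t ps rule: lower.induct)
  case (3 c l ls us t ts ps)
  show ?case
  proof (cases "t = 0 \<or> l = 0")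
    case True then show ?thesis using 3 by simp
  next
    case False
    have "\<forall>(c, t)\<in>set (add_term (c * l) (us @ (t - 1) # ts) ps). length t = n"
      by (rule add_term_length) (use 3 in auto)
    then show ?thesis using 3 False by simp
  qed
qed auto

lemma lower_all_length:
  "\<forall>(c, t)\<in>set ps. length t = n \<Longrightarrow> \<forall>(c, t)\<in>set qs. length t = n \<Longrightarrow>
    \<forall>(c, t)\<in>set (lower_all l qs ps). length t = n"
proof (induction l qs ps rule: lower_all.induct)
  case (2 l c t qs ps)
  have "\<forall>(c, t)\<in>set (lower c l [] t ps). length t = n"
    by (rule lower_length) (use 2 in auto)
  then show ?case using 2 by auto
qed simp

lemma coeff_run_state_value:
  assumes "\<forall>l\<in>set ls. length l = n" "\<forall>(c, t)\<in>set ps. length t = n"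
  shows "coeff_run ls ps = state_value ls ps"
  using assms
proof (induction ls arbitrary: ps)
  case Nil
  show ?case by (simp add: case_prod_beta list_all_length, intro arg_cong[where f = sum_list] map_cong) auto
next
  case (Cons l ls)
  have "coeff_run ls (lower_all l ps []) = state_value ls (lower_all l ps [])"
    by (rule Cons.IH) (use Cons.prems lower_all_length[of "[]" n ps l] in auto)
  then show ?case using state_value_lower_all[of ps l ls "[]"] Cons.prems by simp
qed

lemma lin_coeff_eq_coeff_run:
  assumes "\<forall>l\<in>set ls. length l = length t"
  shows "lin_coeff ls t = coeff_run ls [(1, t)]"
  using coeff_run_state_value[OF assms, of "[(1, t)]"] by simp

text \<open>Pads to an exact length: the number of affine factors must equal the total exponent, so
  at most \<open>n\<close> forbidden sums are listed as exactly \<open>n\<close> values.\<close>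

lemma subset_list_of_card_le:
  assumes "finite S" "card S \<le> n"
  shows "\<exists>l. length l = n \<and> S \<subseteq> set l"
proof -
  obtain l where l: "set l = S" "length l = card S" using finite_distinct_list[OF assms(1)] distinct_card by metis
  show ?thesis using assms(2) l by (intro exI[of _ "l @ replicate (n - card S) undefined"]) auto
qed

lemma subset_of_card_le_3:
  assumes "finite S" "card S \<le> 3"
  obtains a b c where "S \<subseteq> {a, b, c}"
proof -
  obtain l where "length l = 3" "S \<subseteq> set l" using subset_list_of_card_le[OF assms] by auto
  then show thesis using that by (auto simp: numeral_eq_Suc length_Suc_conv)
qed

lemma subset_of_card_le_4:
  assumes "finite S" "card S \<le> 4"
  obtains a b c d where "S \<subseteq> {a, b, c, d}"
proof -
  obtain l where "length l = 4" "S \<subseteq> set l" using subset_list_of_card_le[OF assms] by auto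
  then show thesis using that by (auto simp: numeral_eq_Suc length_Suc_conv)
qed

lemma linear_nullstellensatz_list:
  assumes "coeff_run (map fst ls) [(1, t)] \<noteq> 0" "\<forall>l\<in>set (map fst ls). length l = length t" "length ls = sum_list t"
    and "list_all2 (\<lambda>n A. finite A \<and> n < card A) t As"
  obtains xs where "list_all2 (\<in>) xs As" "list_all (\<lambda>(l, c). lin_form (length t) l c xs \<noteq> 0) ls"
proof -
  have c: "lin_coeff (map fst ls) t \<noteq> 0" using assms(1) lin_coeff_eq_coeff_run[OF assms(2)] by simp
  have len: "length As = length t" using assms(4) by (simp add: list_all2_lengthD)
  have cards: "finite (As ! i) \<and> t ! i < card (As ! i)" if "i < length t" for i
    using assms(4) that by (simp add: list_all2_conv_all_nth)
  obtain xs where xs: "length xs = length t" "\<And>i. i < length t \<Longrightarrow> xs ! i \<in> As ! i"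
    "\<And>l c. (l, c) \<in> set ls \<Longrightarrow> lin_form (length t) l c xs \<noteq> 0"
    using linear_nullstellensatz[OF c assms(3) len cards] by blast
  show thesis
    by (rule that[of xs]) (use xs len in \<open>auto simp: list_all2_conv_all_nth list_all_iff\<close>)
qed

lemma lin_form_Cons:
  "lin_form (Suc n) (l # ls) c (x # xs) = of_int l * x + lin_form n ls c xs"
  by (simp add: lin_form_def sum.lessThan_Suc_shift del: sum.lessThan_Suc)

lemma lin_form_Nil: "lin_form 0 ls c xs = c"
  by (simp add: lin_form_def)

text \<open>In the next four lemmas every constraint contributes one affine factor, and the exponent vector is
  bounded by the list sizes minus one. The constants \<open>su\<close>, \<open>st\<close>, \<open>sv\<close> are the partial colour sums of
  a 4-vertex (or two of them) and of their common neighbour.\<close>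

lemma colours_4_4:
  fixes A Y F :: "nat set"
  assumes "5 \<le> card A" "5 \<le> card Y" "3 \<le> card F"
    and "finite U" "card U \<le> 3" "finite W" "card W \<le> 3"
  obtains a y f where "a \<in> A" "y \<in> Y" "f \<in> F"
    "a \<noteq> y" "a \<noteq> f" "y \<noteq> f" "su + a + f \<notin> U" "sv + a + y \<notin> W" "su + f \<noteq> sv + y"
proof -
  obtain u1 u2 u3 where U: "U \<subseteq> {u1, u2, u3}" using subset_of_card_le_3 assms by metis
  obtain w1 w2 w3 where W: "W \<subseteq> {w1, w2, w3}" using subset_of_card_le_3 assms by metis
  \<comment> \<open>\<open>a\<close> is the colour of the edge between two 4-vertices,
    \<open>y\<close> and \<open>f\<close> are the colours of its ends. The edge colour occurs in
    both sums and cancels, which leaves the linear part \<open>y - f\<close>.\<close>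
  let ?ls = "[([1,-1,0], 0),
    ([1,0,-1], 0),
    ([0,1,-1], 0),
    ([0,1,-1], real sv - real su),
    ([1,0,1], real su - real u1),
    ([1,0,1], real su - real u2),
    ([1,0,1], real su - real u3),
    ([1,1,0], real sv - real w1),
    ([1,1,0], real sv - real w2),
    ([1,1,0], real sv - real w3)] :: (int list \<times> real) list"
  \<comment> \<open>There are 10 constraints, exactly the total exponent that lists of sizes 5, 5
    and 3 permit.\<close>
  let ?t = "[4,4,2] :: nat list" and ?As = "[real ` A, real ` Y, real ` F]"
  have c: "coeff_run (map fst ?ls) [(1, ?t)] \<noteq> 0"
  proof -
    have "coeff_run [[1,-1,0],
      [1,0,-1],
      [0,1,-1],
      [0,1,-1],
      [1,0,1],
      [1,0,1],
      [1,0,1],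
      [1,1,0],
      [1,1,0],
      [1,1,0]] [(1, ?t)] = 7" by code_simp
    then show ?thesis by (simp only: list.map fst_conv)
  qed
  have fin: "finite A" "finite Y" "finite F" using assms(1-3) by (auto intro: card_ge_0_finite)
  have cards: "list_all2 (\<lambda>n A. finite A \<and> n < card A) ?t ?As"
    using assms(1-3) fin by (simp add: card_image)
  obtain xs where xs: "list_all2 (\<in>) xs ?As" "list_all (\<lambda>(l, c). lin_form (length ?t) l c xs \<noteq> 0) ?ls"
    by (rule linear_nullstellensatz_list[OF c _ _ cards]) simp_all
  obtain a y f where x: "xs = [real a, real y, real f]" "a \<in> A" "y \<in> Y" "f \<in> F"
    using xs(1) by (auto simp: list_all2_Cons2)
  have *: "a \<noteq> y \<and> a \<noteq> f \<and> y \<noteq> f \<and>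
    su + f \<noteq> sv + y \<and> su + a + f \<notin> {u1, u2, u3} \<and> sv + a + y \<notin> {w1, w2, w3}"
    using xs(2) unfolding x(1) by (auto simp: lin_form_Cons lin_form_Nil)
  show thesis by (rule that[of a y f]) (use * x(2-) U W in auto)
qed

lemma colours_6:
  fixes X A Y F :: "nat set"
  assumes "5 \<le> card X" "4 \<le> card A" "3 \<le> card Y" "5 \<le> card F"
    and "finite U" "card U \<le> 3" "finite W" "card W \<le> 4"
  obtains x a y f where "x \<in> X" "a \<in> A" "y \<in> Y" "f \<in> F"
    "x \<noteq> a" "x \<noteq> y" "a \<noteq> y" "a \<noteq> f" "y \<noteq> f" "su + a + f \<notin> U" "sv + x + a + y \<notin> W" "su + f \<noteq> sv + x + y"
proof -
  obtain u1 u2 u3 where U: "U \<subseteq> {u1, u2, u3}" using subset_of_card_le_3 assms by metis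
  obtain w1 w2 w3 w4 where W: "W \<subseteq> {w1, w2, w3, w4}" using subset_of_card_le_4 assms by metis
  let ?ls = "[([1,-1,0,0], 0),
    ([1,0,-1,0], 0),
    ([0,1,-1,0], 0),
    ([0,1,0,-1], 0),
    ([0,0,1,-1], 0),
    ([0,1,0,1], real su - real u1),
    ([0,1,0,1], real su - real u2),
    ([0,1,0,1], real su - real u3),
    ([1,0,1,-1], real sv - real su),
    ([1,1,1,0], real sv - real w1),
    ([1,1,1,0], real sv - real w2),
    ([1,1,1,0], real sv - real w3),
    ([1,1,1,0], real sv - real w4)] :: (int list \<times> real) list"
  let ?t = "[4,3,2,4] :: nat list" and ?As = "[real ` X, real ` A, real ` Y, real ` F]"
  have c: "coeff_run (map fst ?ls) [(1, ?t)] \<noteq> 0"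
  proof -
    have "coeff_run [[1,-1,0,0],
      [1,0,-1,0],
      [0,1,-1,0],
      [0,1,0,-1],
      [0,0,1,-1],
      [0,1,0,1],
      [0,1,0,1],
      [0,1,0,1],
      [1,0,1,-1],
      [1,1,1,0],
      [1,1,1,0],
      [1,1,1,0],
      [1,1,1,0]] [(1, ?t)] = 10" by code_simp
    then show ?thesis by (simp only: list.map fst_conv)
  qed
  have fin: "finite X" "finite A" "finite Y" "finite F" using assms(1-4) by (auto intro: card_ge_0_finite)
  have cards: "list_all2 (\<lambda>n A. finite A \<and> n < card A) ?t ?As"
    using assms(1-4) fin by (simp add: card_image)
  obtain xs where xs: "list_all2 (\<in>) xs ?As" "list_all (\<lambda>(l, c). lin_form (length ?t) l c xs \<noteq> 0) ?ls"
    by (rule linear_nullstellensatz_list[OF c _ _ cards]) simp_all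
  obtain x a y f where x: "xs = [real x, real a, real y, real f]" "x \<in> X" "a \<in> A" "y \<in> Y" "f \<in> F"
    using xs(1) by (auto simp: list_all2_Cons2)
  have *: "x \<noteq> a \<and> x \<noteq> y \<and> a \<noteq> y \<and> a \<noteq> f \<and> y \<noteq> f \<and>
    su + f \<noteq> sv + x + y \<and> su + a + f \<notin> {u1, u2, u3} \<and> sv + x + a + y \<notin> {w1, w2, w3, w4}"
    using xs(2) unfolding x(1)
    by (auto simp: lin_form_Cons lin_form_Nil)
      (drule arg_cong[where f = real], simp only: of_nat_add, argo)+
  show thesis by (rule that[of x a y f]) (use * x(2-) U W in auto)
qed

lemma colours_7:
  fixes X Z A F :: "nat set"
  assumes "5 \<le> card X" "4 \<le> card Z" "3 \<le> card A" "4 \<le> card F"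
    and "finite U" "card U \<le> 3" "finite W" "card W \<le> 4"
  obtains x z a f where "x \<in> X" "z \<in> Z" "a \<in> A" "f \<in> F"
    "x \<noteq> z" "x \<noteq> a" "z \<noteq> a" "a \<noteq> f" "su + a + f \<notin> U" "sv + x + z + a \<notin> W" "su + f \<noteq> sv + x + z"
proof -
  obtain u1 u2 u3 where U: "U \<subseteq> {u1, u2, u3}" using subset_of_card_le_3 assms by metis
  obtain w1 w2 w3 w4 where W: "W \<subseteq> {w1, w2, w3, w4}" using subset_of_card_le_4 assms by metis
  let ?ls = "[([1,-1,0,0], 0),
    ([1,0,-1,0], 0),
    ([0,1,-1,0], 0),
    ([0,0,1,-1], 0),
    ([0,0,1,1], real su - real u1),
    ([0,0,1,1], real su - real u2),
    ([0,0,1,1], real su - real u3),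
    ([1,1,0,-1], real sv - real su),
    ([1,1,1,0], real sv - real w1),
    ([1,1,1,0], real sv - real w2),
    ([1,1,1,0], real sv - real w3),
    ([1,1,1,0], real sv - real w4)] :: (int list \<times> real) list"
  let ?t = "[4,3,2,3] :: nat list" and ?As = "[real ` X, real ` Z, real ` A, real ` F]"
  have c: "coeff_run (map fst ?ls) [(1, ?t)] \<noteq> 0"
  proof -
    have "coeff_run [[1,-1,0,0],
      [1,0,-1,0],
      [0,1,-1,0],
      [0,0,1,-1],
      [0,0,1,1],
      [0,0,1,1],
      [0,0,1,1],
      [1,1,0,-1],
      [1,1,1,0],
      [1,1,1,0],
      [1,1,1,0],
      [1,1,1,0]] [(1, ?t)] = -6" by code_simp
    then show ?thesis by (simp only: list.map fst_conv)
  qed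
  have fin: "finite X" "finite Z" "finite A" "finite F" using assms(1-4) by (auto intro: card_ge_0_finite)
  have cards: "list_all2 (\<lambda>n A. finite A \<and> n < card A) ?t ?As"
    using assms(1-4) fin by (simp add: card_image)
  obtain xs where xs: "list_all2 (\<in>) xs ?As" "list_all (\<lambda>(l, c). lin_form (length ?t) l c xs \<noteq> 0) ?ls"
    by (rule linear_nullstellensatz_list[OF c _ _ cards]) simp_all
  obtain x z a f where x: "xs = [real x, real z, real a, real f]" "x \<in> X" "z \<in> Z" "a \<in> A" "f \<in> F"
    using xs(1) by (auto simp: list_all2_Cons2)
  have *: "x \<noteq> z \<and> x \<noteq> a \<and> z \<noteq> a \<and> a \<noteq> f \<and>
    su + f \<noteq> sv + x + z \<and> su + a + f \<notin> {u1, u2, u3} \<and> sv + x + z + a \<notin> {w1, w2, w3, w4}"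
    using xs(2) unfolding x(1)
    by (auto simp: lin_form_Cons lin_form_Nil)
      (drule arg_cong[where f = real], simp only: of_nat_add, argo)+
  show thesis by (rule that[of x z a f]) (use * x(2-) U W in auto)
qed

lemma colours_5:
  fixes A B Y F G :: "nat set"
  assumes "5 \<le> card A" "5 \<le> card B" "5 \<le> card Y" "3 \<le> card F" "5 \<le> card G"
    and "finite U" "card U \<le> 3" "finite T" "card T \<le> 3" "finite W" "card W \<le> 3"
  obtains a b y f g where "a \<in> A" "b \<in> B" "y \<in> Y" "f \<in> F" "g \<in> G"
    "a \<noteq> b" "a \<noteq> y" "b \<noteq> y" "a \<noteq> f" "b \<noteq> g" "y \<noteq> f" "y \<noteq> g"
    "su + a + f \<notin> U" "st + b + g \<notin> T" "sv + a + b + y \<notin> W"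
    "su + f \<noteq> sv + b + y" "st + g \<noteq> sv + a + y"
proof -
  obtain u1 u2 u3 where U: "U \<subseteq> {u1, u2, u3}" using subset_of_card_le_3 assms by metis
  obtain t1 t2 t3 where T: "T \<subseteq> {t1, t2, t3}" using subset_of_card_le_3 assms by metis
  obtain w1 w2 w3 where W: "W \<subseteq> {w1, w2, w3}" using subset_of_card_le_3 assms by metis
  let ?ls = "[([1,0,0,-1,0], 0),
    ([0,0,-1,1,0], 0),
    ([1,0,0,1,0], real su - real u1),
    ([1,0,0,1,0], real su - real u2),
    ([1,0,0,1,0], real su - real u3),
    ([0,1,1,-1,0], real sv - real su),
    ([0,1,0,0,-1], 0),
    ([0,0,-1,0,1], 0),
    ([0,1,0,0,1], real st - real t1),
    ([0,1,0,0,1], real st - real t2),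
    ([0,1,0,0,1], real st - real t3),
    ([1,0,1,0,-1], real sv - real st),
    ([1,-1,0,0,0], 0),
    ([1,0,-1,0,0], 0),
    ([0,1,-1,0,0], 0),
    ([1,1,1,0,0], real sv - real w1),
    ([1,1,1,0,0], real sv - real w2),
    ([1,1,1,0,0], real sv - real w3)] :: (int list \<times> real) list"
  \<comment> \<open>The exponents of \<open>F\<close> and \<open>G\<close> differ although their
    roles are symmetric: with 18 constraints the five exponents cannot all be 4, and this choice has
    the nonzero coefficient 8.\<close>
  let ?t = "[4,4,4,2,4] :: nat list" and ?As = "[real ` A, real ` B, real ` Y, real ` F, real ` G]"
  have c: "coeff_run (map fst ?ls) [(1, ?t)] \<noteq> 0"
  proof -
    have "coeff_run [[1,0,0,-1,0],
      [0,0,-1,1,0],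
      [1,0,0,1,0],
      [1,0,0,1,0],
      [1,0,0,1,0],
      [0,1,1,-1,0],
      [0,1,0,0,-1],
      [0,0,-1,0,1],
      [0,1,0,0,1],
      [0,1,0,0,1],
      [0,1,0,0,1],
      [1,0,1,0,-1],
      [1,-1,0,0,0],
      [1,0,-1,0,0],
      [0,1,-1,0,0],
      [1,1,1,0,0],
      [1,1,1,0,0],
      [1,1,1,0,0]] [(1, ?t)] = 8" by code_simp
    then show ?thesis by (simp only: list.map fst_conv)
  qed
  have fin: "finite A" "finite B" "finite Y" "finite F" "finite G" using assms(1-5) by (auto intro: card_ge_0_finite)
  have cards: "list_all2 (\<lambda>n A. finite A \<and> n < card A) ?t ?As"
    using assms(1-5) fin by (simp add: card_image)
  obtain xs where xs: "list_all2 (\<in>) xs ?As" "list_all (\<lambda>(l, c). lin_form (length ?t) l c xs \<noteq> 0) ?ls"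
    by (rule linear_nullstellensatz_list[OF c _ _ cards]) simp_all
  obtain a b y f g where x: "xs = [real a, real b, real y, real f, real g]" "a \<in> A" "b \<in> B" "y \<in> Y" "f \<in> F" "g \<in> G"
    using xs(1) by (auto simp: list_all2_Cons2)
  have *: "a \<noteq> b \<and> a \<noteq> y \<and> b \<noteq> y \<and> a \<noteq> f \<and> b \<noteq> g \<and> y \<noteq> f \<and> y \<noteq> g \<and>
    su + f \<noteq> sv + b + y \<and> st + g \<noteq> sv + a + y \<and> su + a + f \<notin> {u1, u2, u3} \<and>
    st + b + g \<notin> {t1, t2, t3} \<and> sv + a + b + y \<notin> {w1, w2, w3}"
    using xs(2) unfolding x(1)
    by (auto simp: lin_form_Cons lin_form_Nil)
      (drule arg_cong[where f = real], simp only: of_nat_add, argo)+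
  show thesis by (rule that[of a b y f g]) (use * x(2-) U T W in auto)
qed

section \<open>Sums of distinct representatives\<close>

definition sdr :: "'i set \<Rightarrow> ('i \<Rightarrow> nat set) \<Rightarrow> ('i \<Rightarrow> nat) \<Rightarrow> bool" where
  "sdr I A x \<longleftrightarrow> inj_on x I \<and> (\<forall>i\<in>I. x i \<in> A i)"

text \<open>Equivalently, the sets can be ordered so that the \<open>i\<close>-th one (counting from 1) has at least \<open>i + e\<close>
  elements.\<close>

definition surplus :: "'i set \<Rightarrow> ('i \<Rightarrow> nat set) \<Rightarrow> nat \<Rightarrow> bool" where
  "surplus I A e \<longleftrightarrow> (\<forall>J\<subseteq>I. J \<noteq> {} \<longrightarrow> (\<exists>j\<in>J. card J + e \<le> card (A j)))"

lemma surplus_subset: "surplus I A e \<Longrightarrow> J \<subseteq> I \<Longrightarrow> surplus J A e"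
  unfolding surplus_def by (meson subset_trans)

text \<open>Greedy, with a large list served last: some list has at least \<open>card I\<close>
  elements, and the representatives of the other indices cannot exhaust it.\<close>

lemma sdr_exists:
  assumes "finite I" "\<And>i. i \<in> I \<Longrightarrow> finite (A i)" "surplus I A 0"
  shows "\<exists>x. sdr I A x"
  using assms
proof (induction "card I" arbitrary: I)
  case 0
  then show ?case by (simp add: sdr_def)
next
  case (Suc n)
  then have "I \<noteq> {}" by auto
  then obtain i where i: "i \<in> I" "card I \<le> card (A i)"
    using Suc.prems(3) unfolding surplus_def by (metis add.right_neutral subset_refl)
  have cI: "card (I - {i}) = n" using i Suc by simp
  have "surplus (I - {i}) A 0" using Suc.prems(3) by (rule surplus_subset) auto
  then obtain x where x: "sdr (I - {i}) A x" using Suc.hyps(1)[of "I - {i}"] Suc.prems cI by auto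
  have "card (x ` (I - {i})) < card (A i)"
    using cI i Suc.hyps(2) card_image_le[of "I - {i}" x] Suc.prems(1) by simp
  then obtain a where "a \<in> A i" "a \<notin> x ` (I - {i})"
    by (metis Suc.prems(1) card_mono finite_Diff finite_imageI not_le subsetI)
  then have "sdr I A (x(i := a))"
    using x unfolding sdr_def by (auto simp: inj_on_def)
  then show ?case by blast
qed

text \<open>An alternating path: \<open>i\<close> takes \<open>\<psi> i\<close>; if this value is
  already \<open>\<phi> k\<close>, then \<open>k\<close> gives it up and moves to
  \<open>\<psi> k\<close>, and so on. The path ends at a new value \<open>y\<close>, so the old
  values all stay in use.\<close>

lemma sdr_augment:
  assumes "finite I" "i \<notin> I" "inj_on \<phi> I" "inj_on \<psi> (insert i I)"
  shows "\<exists>\<chi> y. inj_on \<chi> (insert i I) \<and> (\<forall>j\<in>insert i I. \<chi> j = \<phi> j \<and> j \<noteq> i \<or> \<chi> j = \<psi> j) \<and>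
    \<chi> ` insert i I = insert y (\<phi> ` I) \<and> y \<notin> \<phi> ` I \<and> y \<in> \<psi> ` insert i I"
  using assms
proof (induction "card I" arbitrary: I i)
  case 0
  then show ?case by (intro exI[of _ \<psi>] exI[of _ "\<psi> i"]) auto
next
  case (Suc n)
  show ?case
  proof (cases "\<psi> i \<in> \<phi> ` I")
    case False
    let ?\<chi> = "\<phi>(i := \<psi> i)"
    have "?\<chi> ` I = \<phi> ` I" using Suc.prems(2) by (intro image_cong) auto
    then have img: "?\<chi> ` insert i I = insert (\<psi> i) (\<phi> ` I)" by (simp only: image_insert fun_upd_same)
    have "inj_on ?\<chi> I" using Suc.prems(2,3) by (subst inj_on_cong[of _ _ \<phi>]) auto
    moreover have "?\<chi> i \<notin> ?\<chi> ` (I - {i})" using False by auto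
    ultimately have "inj_on ?\<chi> (insert i I)" unfolding inj_on_insert by blast
    then show ?thesis using img False Suc.prems(2)
      by (intro exI[of _ ?\<chi>] exI[of _ "\<psi> i"] conjI) auto
  next
    case True
    then obtain k where k: "k \<in> I" "\<psi> i = \<phi> k" by auto
    let ?J = "I - {k}"
    have J: "insert k ?J = I" using k by auto
    have "n = card ?J" using Suc k by simp
    moreover have "finite ?J" "k \<notin> ?J" "inj_on \<phi> ?J" "inj_on \<psi> (insert k ?J)"
      using Suc.prems(1) inj_on_subset[OF Suc.prems(3)] inj_on_subset[OF Suc.prems(4)] J by blast+
    ultimately obtain \<chi> y where \<chi>: "inj_on \<chi> I"
      "\<forall>j\<in>I. \<chi> j = \<phi> j \<and> j \<noteq> k \<or> \<chi> j = \<psi> j" "\<chi> ` I = insert y (\<phi> ` ?J)" "y \<notin> \<phi> ` ?J" "y \<in> \<psi> ` I"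
      using Suc.hyps(1)[of ?J k] unfolding J by blast
    let ?\<chi> = "\<chi>(i := \<psi> i)"
    \<comment> \<open>\<open>\<phi> k\<close> equals \<open>\<psi> i\<close>, whereas
      \<open>y\<close> is a value of the injective \<open>\<psi>\<close> at an index other than
      \<open>i\<close>.\<close>
    have yk: "y \<noteq> \<phi> k" using \<chi>(5) k Suc.prems(2,4) by (auto simp: inj_on_def)
    have kJ: "\<phi> k \<notin> \<phi> ` ?J" using Suc.prems(3) k by (auto simp: inj_on_def)
    have "?\<chi> ` I = \<chi> ` I" using Suc.prems(2) by (intro image_cong) auto
    then have imgI: "?\<chi> ` I = insert y (\<phi> ` ?J)" using \<chi>(3) by simp
    have img: "?\<chi> ` insert i I = insert y (\<phi> ` I)" 
      using imgI k J by (metis fun_upd_same image_insert insert_commute)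
    have "inj_on ?\<chi> I" using Suc.prems(2) \<chi>(1) by (subst inj_on_cong[of _ _ \<chi>]) auto
    moreover have "?\<chi> i \<notin> ?\<chi> ` I" unfolding imgI using k(2) yk kJ by auto
    ultimately have "inj_on ?\<chi> (insert i I)" unfolding inj_on_insert by blast
    moreover have "y \<notin> \<phi> ` I" using \<chi>(4) yk J by (metis image_insert insert_iff)
    ultimately show ?thesis using img \<chi>(2,5) Suc.prems(2)
      by (intro exI[of _ ?\<chi>] exI[of _ y] conjI) auto
  qed
qed

text \<open>The index \<open>i\<close> has the smallest list among those containing
  \<open>m\<close>. If \<open>J\<close> meets these lists, \<open>surplus\<close> is applied to
  \<open>insert i J\<close>: the larger set pays for the loss of \<open>m\<close>, and should the
  witness be \<open>i\<close> itself, a member of \<open>J\<close> with a list at least as large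
  replaces it.\<close>

lemma surplus_remove_element:
  assumes fin: "finite I" "\<And>i. i \<in> I \<Longrightarrow> finite (A i)" and S: "surplus I A e"
    and m: "\<exists>i\<in>I. m \<in> A i"
  shows "\<exists>i\<in>I. m \<in> A i \<and> surplus (I - {i}) (\<lambda>j. A j - {m}) e"
proof -
  let ?M = "{i \<in> I. m \<in> A i}"
  have "finite ?M" "?M \<noteq> {}" using fin m by auto
  then obtain i where i: "i \<in> ?M" "\<And>j. j \<in> ?M \<Longrightarrow> card (A i) \<le> card (A j)"
    using arg_min_if_finite[of ?M "\<lambda>i. card (A i)"] that[of "arg_min_on (\<lambda>i. card (A i)) ?M"]
    by (meson not_le)
  have "\<exists>j\<in>J. card J + e \<le> card (A j - {m})" if J: "J \<subseteq> I - {i}" "J \<noteq> {}" for J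
  proof (cases "J \<inter> ?M = {}")
    case True
    then have "A j - {m} = A j" if "j \<in> J" for j using that J by auto
    moreover have "J \<subseteq> I" using J by auto
    ultimately show ?thesis using S J(2) unfolding surplus_def by metis
  next
    case False
    then obtain j' where j': "j' \<in> J" "j' \<in> ?M" by auto
    have "insert i J \<subseteq> I" using J i by auto
    then obtain j where j: "j \<in> insert i J" "card (insert i J) + e \<le> card (A j)"
      using S unfolding surplus_def by blast
    have "finite J" "i \<notin> J" using J fin(1) by (auto intro: finite_subset)
    then have "card (insert i J) = card J + 1" by simp
    then have jc: "card J + 1 + e \<le> card (A j)" using j(2) by simp
    obtain l where l: "l \<in> J" "card J + 1 + e \<le> card (A l)"
    proof (cases "j = i")
      case True
      then have "card J + 1 + e \<le> card (A j')" using jc i(2)[OF j'(2)] by simp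
      then show ?thesis using that j'(1) by blast
    next
      case False
      then show ?thesis using that j(1) jc by blast
    qed
    have "card (A l) \<le> card (A l - {m}) + 1"
      using card_Suc_Diff1[of "A l" m] fin l J by (cases "m \<in> A l") auto
    then show ?thesis using l by (intro bexI[of _ l]) auto
  qed
  then show ?thesis using i(1) unfolding surplus_def by blast
qed

text \<open>Representatives that use the least available value \<open>m\<close> give \<open>(n - 1) e + 1\<close> sums by induction. In the one
  of largest sum, \<open>m\<close> can be exchanged for at least \<open>e\<close> larger values: otherwise delete these values and \<open>m\<close>,
  take representatives of what is left, and augment.\<close>

theorem sdr_sums_card:
  assumes "finite I" "\<And>i. i \<in> I \<Longrightarrow> finite (A i)" "surplus I A e"
  shows "card I * e + 1 \<le> card {\<Sum>i\<in>I. x i |x. sdr I A x}"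
  using assms
proof (induction "card I" arbitrary: I A)
  case 0
  then have "{\<Sum>i\<in>I. x i |x. sdr I A x} = {0}" by (auto simp: sdr_def)
  then show ?case using 0 by simp
next
  case (Suc n)
  let ?sums = "\<lambda>I A. {\<Sum>i\<in>I. x i |x. sdr I A x}"
  have fin_sums: "finite (?sums I' A')" if "finite I'" "\<And>i. i \<in> I' \<Longrightarrow> finite (A' i)" for I' :: "'a set" and A'
  proof (rule finite_subset)
    show "?sums I' A' \<subseteq> {..\<Sum>i\<in>I'. Max (A' i)}"
    proof
      fix s assume "s \<in> ?sums I' A'"
      then obtain x where "s = (\<Sum>i\<in>I'. x i)" "sdr I' A' x" by auto
      then show "s \<in> {..\<Sum>i\<in>I'. Max (A' i)}" using that by (auto simp: sdr_def intro!: sum_mono)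
    qed
  qed simp
  let ?U = "\<Union>i\<in>I. A i"
  have "I \<noteq> {}" using Suc by auto
  then obtain j where "j \<in> I" "card I + e \<le> card (A j)"
    using Suc.prems(3) unfolding surplus_def by blast
  then have "A j \<noteq> {}" using Suc.hyps(2) by auto
  then have U: "?U \<noteq> {}" "finite ?U" using \<open>j \<in> I\<close> by (blast, simp add: Suc.prems(1,2))
  define m where "m = Min ?U"
  have m: "m \<in> ?U" "\<And>y. y \<in> ?U \<Longrightarrow> m \<le> y" 
    unfolding m_def using Min_in[OF U(2,1)] Min_le[OF U(2)] by blast+
  obtain i where i: "i \<in> I" "m \<in> A i" "surplus (I - {i}) (\<lambda>j. A j - {m}) e"
    using surplus_remove_element[of I A e m] Suc.prems m(1) by blast
  let ?I = "I - {i}" and ?A = "\<lambda>j. A j - {m}"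
  have cI: "card ?I = n" "finite ?I" using Suc i by auto
  have IH: "n * e + 1 \<le> card (?sums ?I ?A)" using Suc.hyps(1)[of ?I ?A] Suc.prems cI i by auto
  have fin': "finite (?sums ?I ?A)" using fin_sums[of ?I ?A] Suc.prems by auto
  have ne: "?sums ?I ?A \<noteq> {}" using IH by force
  then have "Max (?sums ?I ?A) \<in> ?sums ?I ?A" using fin' by (rule Max_in[rotated])
  then obtain \<phi> where \<phi>: "sdr ?I ?A \<phi>" "Max (?sums ?I ?A) = sum \<phi> ?I" by auto
  have \<phi>max: "s \<le> sum \<phi> ?I" if "s \<in> ?sums ?I ?A" for s using Max_ge[OF fin' that] \<phi>(2) by simp
  have sum_ins: "sum x I = x i + sum x ?I" for x :: "_ \<Rightarrow> nat" using i Suc.prems(1) by (simp add: sum.remove)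
  have lowS: "(\<lambda>s. m + s) ` ?sums ?I ?A \<subseteq> ?sums I A"
  proof
    fix s assume "s \<in> (\<lambda>s. m + s) ` ?sums ?I ?A"
    then obtain x where x: "s = m + sum x ?I" "sdr ?I ?A x" by auto
    have "sdr I A (x(i := m))" using x(2) i unfolding sdr_def by (auto simp: inj_on_def)
    moreover have "sum (x(i := m)) I = s" using x(1) by (simp add: sum_ins)
    ultimately show "s \<in> ?sums I A" by blast
  qed
  define P where "P = \<phi> ` ?I"
  have P: "finite P" "sum \<phi> ?I = \<Sum>P" using \<phi>(1) cI unfolding P_def sdr_def by (auto simp: sum.reindex)
  \<comment> \<open>The values for which \<open>m\<close> can be exchanged: together with
    \<open>P\<close> they form the set of values of some system of representatives.\<close>
  define Z where "Z = {y. y \<notin> P \<and> y \<noteq> m \<and> (\<exists>\<chi>. sdr I A \<chi> \<and> \<chi> ` I = insert y P)}"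
  have ZU: "Z \<subseteq> ?U"
  proof
    fix y assume "y \<in> Z"
    then obtain \<chi> where "sdr I A \<chi>" "y \<in> \<chi> ` I" unfolding Z_def by auto
    then show "y \<in> ?U" unfolding sdr_def by auto
  qed
  then have finZ: "finite Z" using U finite_subset by blast
  have cardZ: "e \<le> card Z"
  proof (rule ccontr)
    assume "\<not> e \<le> card Z"
    then have cZ: "card (insert m Z) \<le> e" using finZ by (simp add: card_insert_if)
    have "surplus I (\<lambda>j. A j - insert m Z) 0"
      unfolding surplus_def
    proof (intro allI impI)
      fix J assume "J \<subseteq> I" "J \<noteq> {}"
      then obtain j where j: "j \<in> J" "card J + e \<le> card (A j)" using Suc.prems(3) unfolding surplus_def by blast
      have "card (A j) - card (insert m Z) \<le> card (A j - insert m Z)" using finZ by (intro diff_card_le_card_Diff) auto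
      then show "\<exists>j\<in>J. card J + 0 \<le> card (A j - insert m Z)" using j cZ by (intro bexI[of _ j]) auto
    qed
    then obtain \<psi> where \<psi>: "sdr I (\<lambda>j. A j - insert m Z) \<psi>"
      using sdr_exists[of I "\<lambda>j. A j - insert m Z"] Suc.prems by auto
    have I: "insert i ?I = I" using i by auto
    obtain \<chi> y where \<chi>: "inj_on \<chi> I" "\<forall>j\<in>I. \<chi> j = \<phi> j \<and> j \<noteq> i \<or> \<chi> j = \<psi> j"
      "\<chi> ` I = insert y P" "y \<notin> P" "y \<in> \<psi> ` I"
    proof -
      have "inj_on \<phi> ?I" "inj_on \<psi> (insert i ?I)" "i \<notin> ?I"
        using \<phi>(1) \<psi> unfolding I sdr_def by blast+
      then show thesis using that sdr_augment[of ?I i \<phi> \<psi>] cI(2) unfolding I P_def by blast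
    qed
    have "\<chi> j \<in> A j" if "j \<in> I" for j
      using \<chi>(2) that \<phi>(1) \<psi> unfolding sdr_def by (metis Diff_iff singletonD)
    then have "sdr I A \<chi>" using \<chi>(1) unfolding sdr_def by auto
    moreover have "y \<noteq> m" "y \<notin> Z" using \<chi>(5) \<psi> unfolding sdr_def by auto
    ultimately show False using \<chi>(3,4) unfolding Z_def by blast
  qed
  have highS: "(\<lambda>y. y + \<Sum>P) ` Z \<subseteq> ?sums I A"
  proof
    fix s assume "s \<in> (\<lambda>y. y + \<Sum>P) ` Z"
    then obtain y \<chi> where y: "s = y + \<Sum>P" "y \<notin> P" "sdr I A \<chi>" "\<chi> ` I = insert y P" unfolding Z_def by auto
    have "sum \<chi> I = \<Sum>(\<chi> ` I)" using y(3) unfolding sdr_def by (simp add: sum.reindex)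
    then have "sum \<chi> I = s" using y P by simp
    then show "s \<in> ?sums I A" using y(3) by blast
  qed
  \<comment> \<open>Sums that use \<open>m\<close> are at most \<open>m + \<Sum>P\<close> by the
    maximality of \<open>\<phi>\<close>, and every exchange raises this bound because
    \<open>m\<close> is the least value.\<close>
  have disj: "(\<lambda>s. m + s) ` ?sums ?I ?A \<inter> (\<lambda>y. y + \<Sum>P) ` Z = {}"
  proof (rule ccontr)
    assume "\<not> ?thesis"
    then obtain s y where "s \<in> ?sums ?I ?A" "y \<in> Z" "m + s = y + \<Sum>P" by auto
    moreover from this have "s \<le> \<Sum>P" using \<phi>max P by auto
    moreover have "m < y" using m(2)[of y] \<open>y \<in> Z\<close> ZU unfolding Z_def by force
    ultimately show False by linarith
  qed
  have "card ((\<lambda>s. m + s) ` ?sums ?I ?A \<union> (\<lambda>y. y + \<Sum>P) ` Z) = card (?sums ?I ?A) + card Z"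
    using fin' finZ disj by (subst card_Un_disjoint) (auto simp: card_image inj_on_def)
  moreover have "card ((\<lambda>s. m + s) ` ?sums ?I ?A \<union> (\<lambda>y. y + \<Sum>P) ` Z) \<le> card (?sums I A)"
    using lowS highS fin_sums[of I A] Suc.prems by (intro card_mono) auto
  ultimately have "n * e + 1 + e \<le> card (?sums I A)" using IH cardZ by linarith
  moreover have "card I * e + 1 = n * e + 1 + e" unfolding Suc.hyps(2)[symmetric] by simp
  ultimately show ?case by (simp only:)
qed

corollary sdr_avoiding_sums:
  assumes "finite I" "\<And>i. i \<in> I \<Longrightarrow> finite (A i)" "surplus I A e" "finite W" "card W \<le> card I * e"
  obtains x where "sdr I A x" "c + (\<Sum>i\<in>I. x i) \<notin> W"
proof -
  let ?S = "{\<Sum>i\<in>I. x i |x. sdr I A x}"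
  have "\<not> (\<lambda>s. c + s) ` ?S \<subseteq> W"
  proof
    assume "(\<lambda>s. c + s) ` ?S \<subseteq> W"
    then have "card ((\<lambda>s. c + s) ` ?S) \<le> card W" using assms(4) by (rule card_mono[rotated])
    moreover have "card ((\<lambda>s. c + s) ` ?S) = card ?S" by (rule card_image) (auto simp: inj_on_def)
    ultimately show False using sdr_sums_card[OF assms(1-3)] assms(5) by simp
  qed
  then show thesis using that by blast
qed

lemma surplus_empty: "surplus {} A e"
  by (simp add: surplus_def)

text \<open>Builds \<open>surplus\<close> block by block, the most restricted indices first: a
  subset meeting the new block \<open>J\<close> finds its witness there, any other subset lies in
  \<open>I\<close>.\<close>

lemma surplus_Un:
  assumes "finite I" "finite J" "surplus I A e" "\<And>i. i \<in> J \<Longrightarrow> card (I \<union> J) + e \<le> card (A i)"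
  shows "surplus (I \<union> J) A e"
  unfolding surplus_def
proof (intro allI impI)
  fix L assume L: "L \<subseteq> I \<union> J" "L \<noteq> {}"
  show "\<exists>j\<in>L. card L + e \<le> card (A j)"
  proof (cases "L \<inter> J = {}")
    case True
    then have "L \<subseteq> I" using L by auto
    then show ?thesis using assms(3) L(2) unfolding surplus_def by simp
  next
    case False
    then obtain j where j: "j \<in> L" "j \<in> J" by auto
    have "card L \<le> card (I \<union> J)" using L(1) assms(1,2) by (intro card_mono) auto
    then show ?thesis using j assms(4)[of j] by (intro bexI[of _ j]) auto
  qed
qed

section \<open>Partial colourings\<close>

definition nbrs :: "'a set set \<Rightarrow> 'a \<Rightarrow> 'a set" where
  "nbrs E v = {u. {v, u} \<in> E}"

text \<open>Every edge is coloured, but only the vertices in \<open>B\<close> are; values of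
  \<open>f\<close> outside \<open>B\<close> are never inspected. Erasing vertex colours thus amounts
  to shrinking \<open>B\<close>.\<close>

definition partial_tnsd :: "'a set set \<Rightarrow> nat \<Rightarrow> 'a set \<Rightarrow> ('a \<Rightarrow> nat) \<Rightarrow> ('a set \<Rightarrow> nat) \<Rightarrow> bool" where
  "partial_tnsd E k B f g \<longleftrightarrow>
     (\<forall>v\<in>B. f v \<in> {1..k}) \<and> (\<forall>e\<in>E. g e \<in> {1..k}) \<and>
     (\<forall>e1\<in>E. \<forall>e2\<in>E. e1 \<noteq> e2 \<and> e1 \<inter> e2 \<noteq> {} \<longrightarrow> g e1 \<noteq> g e2) \<and>
     (\<forall>e\<in>E. \<forall>v\<in>e \<inter> B. g e \<noteq> f v) \<and>
     (\<forall>u\<in>B. \<forall>v\<in>B. {u, v} \<in> E \<longrightarrow> f u \<noteq> f v \<and> colour_sum E f g u \<noteq> colour_sum E f g v)"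

lemma partial_tnsdI:
  assumes "\<And>v. v \<in> B \<Longrightarrow> f v \<in> {1..k}" "\<And>e. e \<in> E \<Longrightarrow> g e \<in> {1..k}"
    and "\<And>e1 e2. e1 \<in> E \<Longrightarrow> e2 \<in> E \<Longrightarrow> e1 \<noteq> e2 \<Longrightarrow> e1 \<inter> e2 \<noteq> {} \<Longrightarrow> g e1 \<noteq> g e2"
    and "\<And>e v. e \<in> E \<Longrightarrow> v \<in> e \<inter> B \<Longrightarrow> g e \<noteq> f v"
    and "\<And>u v. u \<in> B \<Longrightarrow> v \<in> B \<Longrightarrow> {u, v} \<in> E \<Longrightarrow> f u \<noteq> f v \<and> colour_sum E f g u \<noteq> colour_sum E f g v"
  shows "partial_tnsd E k B f g"
  unfolding partial_tnsd_def
proof (intro conjI)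
  show "\<forall>e1\<in>E. \<forall>e2\<in>E. e1 \<noteq> e2 \<and> e1 \<inter> e2 \<noteq> {} \<longrightarrow> g e1 \<noteq> g e2"
    by (intro ballI impI, elim conjE, rule assms(3))
qed (intro ballI impI, rule assms, assumption+)+

lemma partial_tnsdD:
  assumes "partial_tnsd E k B f g"
  shows "\<And>v. v \<in> B \<Longrightarrow> f v \<in> {1..k}" "\<And>e. e \<in> E \<Longrightarrow> g e \<in> {1..k}"
    and "\<And>e1 e2. e1 \<in> E \<Longrightarrow> e2 \<in> E \<Longrightarrow> e1 \<noteq> e2 \<Longrightarrow> e1 \<inter> e2 \<noteq> {} \<Longrightarrow> g e1 \<noteq> g e2"
    and "\<And>e v. e \<in> E \<Longrightarrow> v \<in> e \<Longrightarrow> v \<in> B \<Longrightarrow> g e \<noteq> f v"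
    and "\<And>u v. u \<in> B \<Longrightarrow> v \<in> B \<Longrightarrow> {u, v} \<in> E \<Longrightarrow> f u \<noteq> f v"
  using assms unfolding partial_tnsd_def by simp_all

lemma partial_tnsd_iff:
  assumes "simple_graph V E"
  shows "tnsd_colouring V E k f g \<longleftrightarrow> partial_tnsd E k V f g"
proof -
  have "e \<inter> V = e" if "e \<in> E" for e using assms that unfolding simple_graph_def by auto
  then have 1: "(\<forall>e\<in>E. \<forall>v\<in>e \<inter> V. g e \<noteq> f v) \<longleftrightarrow> (\<forall>e\<in>E. \<forall>v\<in>e. g e \<noteq> f v)" by simp
  have 2: "(\<forall>u\<in>V. \<forall>v\<in>V. {u, v} \<in> E \<longrightarrow> f u \<noteq> f v \<and> colour_sum E f g u \<noteq> colour_sum E f g v) \<longleftrightarrow>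
    (\<forall>u\<in>V. \<forall>v\<in>V. {u, v} \<in> E \<longrightarrow> f u \<noteq> f v) \<and>
    (\<forall>u\<in>V. \<forall>v\<in>V. {u, v} \<in> E \<longrightarrow> colour_sum E f g u \<noteq> colour_sum E f g v)" by blast
  show ?thesis
    unfolding tnsd_colouring_def proper_total_colouring_def partial_tnsd_def 1 2 by (simp only: conj_ac)
qed

lemma partial_tnsd_subset: "partial_tnsd E k B f g \<Longrightarrow> C \<subseteq> B \<Longrightarrow> partial_tnsd E k C f g"
  unfolding partial_tnsd_def by (simp add: subset_iff)

lemma simple_graph_subset: "simple_graph V E \<Longrightarrow> E' \<subseteq> E \<Longrightarrow> simple_graph V E'"
  unfolding simple_graph_def by blast

lemma nbrs_sym: "u \<in> nbrs E v \<longleftrightarrow> v \<in> nbrs E u"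
  by (simp add: nbrs_def insert_commute)

lemma simple_graph_finite: 
  assumes "simple_graph V E"
  shows "finite V" "finite E" "finite (incident_edges E v)" "finite (nbrs E v)" "nbrs E v \<subseteq> V"
proof -
  have E: "E \<subseteq> Pow V" "finite V" using assms unfolding simple_graph_def by auto
  then show "finite V" "finite E" using finite_subset by auto
  then show "finite (incident_edges E v)" unfolding incident_edges_def by auto
  show N: "nbrs E v \<subseteq> V" using E unfolding nbrs_def by auto
  then show "finite (nbrs E v)" using E(2) finite_subset by auto
qed

lemma not_self_nbr: "simple_graph V E \<Longrightarrow> v \<notin> nbrs E v"
  unfolding simple_graph_def nbrs_def by force

lemma incident_edges_image:
  assumes "simple_graph V E"
  shows "incident_edges E v = (\<lambda>u. {v, u}) ` nbrs E v"
proof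
  show "incident_edges E v \<subseteq> (\<lambda>u. {v, u}) ` nbrs E v"
  proof
    fix e assume "e \<in> incident_edges E v"
    then have e: "e \<in> E" "v \<in> e" "card e = 2" using assms unfolding incident_edges_def simple_graph_def by auto
    then obtain a b where "e = {a, b}" "a \<noteq> b" by (auto simp: card_2_iff)
    then have "e = {v, if a = v then b else a}" using e(2) by auto
    then show "e \<in> (\<lambda>u. {v, u}) ` nbrs E v" using e(1) unfolding nbrs_def by blast
  qed
qed (auto simp: incident_edges_def nbrs_def)

lemma inj_on_star: "inj_on (\<lambda>u. {v, u}) S"
  by (auto simp: inj_on_def doubleton_eq_iff)

lemma degree_eq_card_nbrs: "simple_graph V E \<Longrightarrow> degree E v = card (nbrs E v)"
  by (simp add: degree_def incident_edges_image card_image inj_on_star)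

lemma colour_sum_fun_upd: "w \<noteq> v \<Longrightarrow> colour_sum E (f(v := c)) g w = colour_sum E f g w"
  by (simp add: colour_sum_def)

lemma extend_vertex:
  assumes G: "simple_graph V E" and P: "partial_tnsd E k B f g" and v: "v \<notin> B" and d: "3 * degree E v < k"
  shows "\<exists>c. partial_tnsd E k (insert v B) (f(v := c)) g"
proof -
  let ?N = "nbrs E v" and ?s = "\<Sum>e\<in>incident_edges E v. g e"
  \<comment> \<open>Natural subtraction truncates: a neighbour sum below \<open>?s\<close> merely
    adds 0, which is not a colour.\<close>
  let ?bad = "g ` incident_edges E v \<union> (f ` ?N \<union> (\<lambda>u. colour_sum E f g u - ?s) ` ?N)"
  have fin: "finite ?N" "finite (incident_edges E v)" using simple_graph_finite[OF G] by auto
  have "card ?bad \<le> card (g ` incident_edges E v) + (card (f ` ?N) + card ((\<lambda>u. colour_sum E f g u - ?s) ` ?N))"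
    by (intro order.trans[OF card_Un_le] add_mono card_Un_le order.refl)
  also have "\<dots> \<le> degree E v + (degree E v + degree E v)"
    using card_image_le[OF fin(1)] card_image_le[OF fin(2)] degree_eq_card_nbrs[OF G]
    unfolding degree_def by (intro add_mono) auto
  finally have "card ?bad < card {1..k}" using d by simp
  then obtain c where c: "c \<in> {1..k}" "c \<notin> ?bad"
    using fin by (metis card_mono finite_UnI finite_imageI not_le subsetI)
  have "partial_tnsd E k (insert v B) (f(v := c)) g"
  proof -
    have *: "(f(v := c)) v \<noteq> f w \<and> colour_sum E (f(v := c)) g v \<noteq> colour_sum E f g w" if "w \<in> ?N" for w
    proof -
      have "c \<noteq> f w" "c \<noteq> colour_sum E f g w - ?s" using c(2) that by auto
      then show ?thesis by (auto simp: colour_sum_def)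
    qed
    have self: "{v, v} \<notin> E" using not_self_nbr[OF G, of v] by (simp add: nbrs_def)
    have sums: "(f(v := c)) a \<noteq> (f(v := c)) b \<and> colour_sum E (f(v := c)) g a \<noteq> colour_sum E (f(v := c)) g b"
      if ab: "a \<in> insert v B" "b \<in> insert v B" "{a, b} \<in> E" for a b
    proof (cases "a = v \<or> b = v")
      case True
      then consider "a = v" "b \<noteq> v" "b \<in> ?N" | "b = v" "a \<noteq> v" "a \<in> ?N"
        using ab self by (metis insert_commute mem_Collect_eq nbrs_def)
      then show ?thesis
      proof cases
        case 1
        then show ?thesis using *[of b] colour_sum_fun_upd[of b v E f c g] by simp
      next
        case 2
        then show ?thesis using *[of a] colour_sum_fun_upd[of a v E f c g] by simp
      qed
    next
      case False
      then show ?thesis using P ab unfolding partial_tnsd_def by (auto simp: colour_sum_fun_upd)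
    qed
    have edge: "g e \<noteq> (f(v := c)) w" if "e \<in> E" "w \<in> e \<inter> insert v B" for e w
    proof (cases "w = v")
      case True
      then show ?thesis using that c(2) by (auto simp: incident_edges_def)
    next
      case False
      then show ?thesis using that P unfolding partial_tnsd_def by auto
    qed
    have "(f(v := c)) w \<in> {1..k}" if "w \<in> insert v B" for w
      using that P c(1) unfolding partial_tnsd_def by auto
    moreover have "g e \<in> {1..k}" if "e \<in> E" for e using that P unfolding partial_tnsd_def by simp
    moreover have "g e1 \<noteq> g e2" if "e1 \<in> E" "e2 \<in> E" "e1 \<noteq> e2" "e1 \<inter> e2 \<noteq> {}" for e1 e2
      using that P unfolding partial_tnsd_def by simp
    ultimately show ?thesis using edge sums by (rule partial_tnsdI)
  qed
  then show ?thesis by blast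
qed

text \<open>The bound of three forbidden colours per neighbour also holds when neighbours are both
  uncoloured, so the missing vertices can be added one at a time in any order.\<close>

lemma extend_small:
  assumes G: "simple_graph V E" and P: "partial_tnsd E k B f g" "B \<subseteq> V"
    and d: "\<And>v. v \<in> V - B \<Longrightarrow> 3 * degree E v < k"
  shows "\<exists>f. partial_tnsd E k V f g"
  using P d
proof (induction "card (V - B)" arbitrary: B f)
  case 0
  then have "B = V" using simple_graph_finite(1)[OF G] by auto
  then show ?case using 0 by blast
next
  case (Suc n)
  then obtain v where v: "v \<in> V - B" by (metis card.empty ex_in_conv nat.simps(3))
  obtain c where c: "partial_tnsd E k (insert v B) (f(v := c)) g"
    using extend_vertex[OF G Suc.prems(1)] v Suc.prems(3) by blast
  have "V - insert v B = (V - B) - {v}" by auto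
  then have "n = card (V - insert v B)" using Suc.hyps(2) v simple_graph_finite(1)[OF G] by simp
  then show ?case using Suc.hyps(1)[of "insert v B"] c v Suc.prems(2,3) by blast
qed

section \<open>Deleting and reinserting a star of edges\<close>

abbreviation star :: "'a \<Rightarrow> 'a set \<Rightarrow> 'a set set" where
  "star v T \<equiv> (\<lambda>u. {v, u}) ` T"

lemma nbrs_delete_star_centre: "nbrs (E - star v T) v = nbrs E v - T"
  by (auto simp: nbrs_def doubleton_eq_iff)

lemma nbrs_delete_star_leaf:
  "u \<in> T \<Longrightarrow> v \<notin> T \<Longrightarrow> nbrs (E - star v T) u = nbrs E u - {v}"
  by (auto simp: nbrs_def doubleton_eq_iff insert_commute)

lemma incident_delete_star_centre:
  "star v T \<subseteq> E \<Longrightarrow> incident_edges E v = incident_edges (E - star v T) v \<union> star v T"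
  by (auto simp: incident_edges_def)

lemma incident_delete_star_leaf:
  "star v T \<subseteq> E \<Longrightarrow> u \<in> T \<Longrightarrow> v \<notin> T \<Longrightarrow> incident_edges E u = insert {v, u} (incident_edges (E - star v T) u)"
  by (auto simp: incident_edges_def)

lemma incident_delete_star_other:
  "w \<noteq> v \<Longrightarrow> w \<notin> T \<Longrightarrow> incident_edges E w = incident_edges (E - star v T) w"
  by (auto simp: incident_edges_def)

text \<open>\<open>K\<close> holds the recoloured vertices. Its leaves are pairwise nonadjacent, so
  two adjacent recoloured vertices always include \<open>v\<close>, and at a leaf only the vertex
  colour and one edge colour change the sum.\<close>

lemma reinsert_star:
  fixes E :: "'a set set" and v :: 'a and T B :: "'a set"
  defines "E' \<equiv> E - star v T" and "K \<equiv> insert v (T \<inter> B)"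
  assumes G: "simple_graph V E" and T: "T \<subseteq> nbrs E v" and v: "v \<in> B"
    and indep: "\<And>u w. u \<in> T \<inter> B \<Longrightarrow> w \<in> T \<inter> B \<Longrightarrow> {u, w} \<notin> E"
    and P: "partial_tnsd E' k (B - K) f g"
    and xinj: "inj_on x T"
    and x: "\<And>u. u \<in> T \<Longrightarrow> x u \<in> {1..k} \<and> x u \<notin> g ` incident_edges E' u \<and> x u \<notin> g ` incident_edges E' v \<and> x u \<noteq> h v"
    and xh: "\<And>u. u \<in> T \<inter> B \<Longrightarrow> x u \<noteq> h u \<and> h u \<noteq> h v"
    and h: "\<And>w. w \<in> K \<Longrightarrow> h w \<in> {1..k} \<and> h w \<notin> g ` incident_edges E' w \<and> h w \<notin> f ` (nbrs E' w \<inter> B)"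
    and sv: "h v + sum g (incident_edges E' v) + sum x T \<notin> colour_sum E' f g ` (nbrs E' v \<inter> B)"
    and su: "\<And>u. u \<in> T \<inter> B \<Longrightarrow> h u + sum g (incident_edges E' u) + x u \<notin> colour_sum E' f g ` (nbrs E' u \<inter> B)"
    and svu: "\<And>u. u \<in> T \<inter> B \<Longrightarrow> h v + sum g (incident_edges E' v) + sum x T \<noteq> h u + sum g (incident_edges E' u) + x u"
  shows "\<exists>f' g'. partial_tnsd E k B f' g'"
proof -
  define f' where "f' w = (if w \<in> K then h w else f w)" for w
  \<comment> \<open>\<open>u \<mapsto> {v, u}\<close> is injective, so the inverse recovers the leaf
    of a star edge.\<close>
  define g' where "g' e = (if e \<in> star v T then x (inv_into T (\<lambda>u. {v, u}) e) else g e)" for e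
  have TE: "star v T \<subseteq> E" using T by (auto simp: nbrs_def)
  have vT: "v \<notin> T" using T not_self_nbr[OF G] by blast
  have EE: "E = E' \<union> star v T" using TE unfolding E'_def by auto
  have fin: "finite (incident_edges E' w)" "finite T" for w
    using simple_graph_finite[OF simple_graph_subset[OF G, of E']] simple_graph_finite[OF G] T
    unfolding E'_def by (auto intro: finite_subset)
  have g'x: "g' {v, u} = x u" if "u \<in> T" for u
    using that inv_into_f_f[OF inj_on_star that, of v] unfolding g'_def by simp
  have g'g: "g' e = g e" if "e \<in> E'" for e using that unfolding g'_def E'_def by auto
  have sum_g: "sum g' (incident_edges E' w) = sum g (incident_edges E' w)" for w
    by (rule sum.cong) (auto simp: incident_edges_def g'g)
  have "incident_edges E' v \<inter> star v T = {}" unfolding E'_def incident_edges_def by auto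
  then have cs_v: "colour_sum E f' g' v = h v + sum g (incident_edges E' v) + sum x T"
    unfolding colour_sum_def incident_delete_star_centre[OF TE] E'_def[symmetric]
    using fin by (subst sum.union_disjoint) (auto simp: sum_g sum.reindex inj_on_star g'x f'_def K_def)
  have cs_u: "colour_sum E f' g' u = h u + sum g (incident_edges E' u) + x u" if u: "u \<in> T \<inter> B" for u
  proof -
    have "{v, u} \<notin> incident_edges E' u" using u unfolding E'_def incident_edges_def by auto
    moreover have "incident_edges E u = insert {v, u} (incident_edges E' u)"
      unfolding E'_def by (rule incident_delete_star_leaf) (use TE u vT in auto)
    ultimately show ?thesis unfolding colour_sum_def using fin u by (simp add: sum_g g'x f'_def K_def)
  qed
  have cs_w: "colour_sum E f' g' w = colour_sum E' f g w" if w: "w \<in> B - K" for w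
  proof -
    have "incident_edges E w = incident_edges E' w"
      unfolding E'_def by (rule incident_delete_star_other) (use w in \<open>auto simp: K_def\<close>)
    then show ?thesis using w unfolding colour_sum_def by (simp add: sum_g f'_def)
  qed
  have KB: "K \<subseteq> B" using v unfolding K_def by auto
  have loop: "{w, w} \<notin> E" for w using not_self_nbr[OF G, of w] by (simp add: nbrs_def)
  have K1: "f' a \<noteq> f' b \<and> colour_sum E f' g' a \<noteq> colour_sum E f' g' b"
    if ab: "a \<in> K" "b \<in> B" "{a, b} \<in> E" for a b
  proof (cases "b \<in> K")
    case True
    then consider "a = v" "b \<in> T \<inter> B" | "b = v" "a \<in> T \<inter> B"
      using ab indep loop unfolding K_def by auto
    then show ?thesis
    proof cases
      case 1
      then show ?thesis using xh[of b] svu[of b] cs_v cs_u[of b] by (auto simp: f'_def K_def)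
    next
      case 2
      then show ?thesis using xh[of a] svu[of a] cs_v cs_u[of a] by (auto simp: f'_def K_def)
    qed
  next
    case False
    then have "{a, b} \<notin> star v T" using ab unfolding K_def by (auto simp: doubleton_eq_iff)
    then have b: "b \<in> nbrs E' a \<inter> B" using ab unfolding E'_def nbrs_def by auto
    then have "f' a \<noteq> f' b" using h[OF ab(1)] ab(1) False by (auto simp: f'_def)
    moreover have "colour_sum E f' g' a \<noteq> colour_sum E' f g b"
    proof (cases "a = v")
      case True
      then show ?thesis using sv b cs_v by auto
    next
      case False
      then have "a \<in> T \<inter> B" using ab unfolding K_def by auto
      then show ?thesis using su b cs_u by auto
    qed
    ultimately show ?thesis using cs_w[of b] False ab by auto
  qed
  have K2: "f' a \<noteq> f' b \<and> colour_sum E f' g' a \<noteq> colour_sum E f' g' b"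
    if ab: "a \<in> B" "b \<in> B" "{a, b} \<in> E" for a b
  proof -
    consider "a \<in> K" | "b \<in> K" | "a \<notin> K" "b \<notin> K" by blast
    then show ?thesis
    proof cases
      case 1 then show ?thesis using K1 ab by blast
    next
      case 2 then show ?thesis using K1[of b a] ab by (metis insert_commute)
    next
      case 3
      then have "{a, b} \<notin> star v T" using ab unfolding K_def by (auto simp: doubleton_eq_iff)
      then have "{a, b} \<in> E'" using ab unfolding E'_def by auto
      then show ?thesis using P 3 ab cs_w[of a] cs_w[of b] unfolding partial_tnsd_def
        by (auto simp: f'_def)
    qed
  qed
  have mixed: "g' e1 \<noteq> g' e2" if e12: "e1 \<in> star v T" "e2 \<in> E'" "e1 \<inter> e2 \<noteq> {}" for e1 e2
  proof -
    obtain u where u: "u \<in> T" "e1 = {v, u}" using e12 by auto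
    then have "e2 \<in> incident_edges E' u \<union> incident_edges E' v" using e12 unfolding incident_edges_def by auto
    then have "x u \<noteq> g e2" using x[OF u(1)] by auto
    then show ?thesis using g'x[OF u(1)] g'g[OF e12(2)] u by auto
  qed
  have edges: "g' e1 \<noteq> g' e2" if e: "e1 \<in> E" "e2 \<in> E" "e1 \<noteq> e2" "e1 \<inter> e2 \<noteq> {}" for e1 e2
  proof -
    consider "e1 \<in> star v T" "e2 \<in> star v T" | "e1 \<in> star v T" "e2 \<in> E'" | "e1 \<in> E'" "e2 \<in> star v T" | "e1 \<in> E'" "e2 \<in> E'"
      using e EE by blast
    then show ?thesis
    proof cases
      case 1
      then obtain u1 u2 where "u1 \<in> T" "u2 \<in> T" "e1 = {v, u1}" "e2 = {v, u2}" by auto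
      then show ?thesis using g'x xinj e(3) by (auto simp: inj_on_def)
    next
      case 2 then show ?thesis using mixed e by blast
    next
      case 3 then show ?thesis using mixed[of e2 e1] e by (metis inf_commute)
    next
      case 4
      then have "g e1 \<noteq> g e2" using P e unfolding partial_tnsd_def by blast
      then show ?thesis using 4 g'g by auto
    qed
  qed
  have ev: "g' e \<noteq> f' w" if e: "e \<in> E" "w \<in> e \<inter> B" for e w
  proof (cases "e \<in> star v T")
    case True
    then obtain u where u: "u \<in> T" "e = {v, u}" by auto
    then have "w = v \<or> w = u \<and> u \<in> T \<inter> B" using e by auto
    then show ?thesis using g'x[OF u(1)] u x[OF u(1)] xh[of u] by (auto simp: f'_def K_def)
  next
    case False
    then have e': "e \<in> E'" "e \<in> incident_edges E' w" using e unfolding E'_def incident_edges_def by auto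
    show ?thesis
    proof (cases "w \<in> K")
      case True
      have "g e \<in> g ` incident_edges E' w" using e'(2) by (rule imageI)
      then have "g e \<noteq> h w" using h[OF True] by metis
      then show ?thesis using True g'g[OF e'(1)] by (simp add: f'_def)
    next
      case False
      then have "g e \<noteq> f w" using P e e'(1) unfolding partial_tnsd_def by blast
      then show ?thesis using g'g[OF e'(1)] False by (auto simp: f'_def)
    qed
  qed
  have rangeg: "g' e \<in> {1..k}" if "e \<in> E" for e
  proof (cases "e \<in> star v T")
    case True
    then show ?thesis using g'x x by auto
  next
    case False
    then have "e \<in> E'" using that unfolding E'_def by auto
    then show ?thesis using P g'g unfolding partial_tnsd_def by auto
  qed
  have rangef: "f' w \<in> {1..k}" if "w \<in> B" for w
    using h[of w] P that unfolding partial_tnsd_def by (auto simp: f'_def)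
  have "partial_tnsd E k B f' g'"
    using rangef rangeg edges ev K2 by (rule partial_tnsdI)
  then show ?thesis by blast
qed

section \<open>Recolouring a star\<close>

lemma sum_positive_set_ge:
  fixes A :: "nat set"
  assumes "finite A" "0 \<notin> A"
  shows "\<Sum>{..card A} \<le> \<Sum>A"
  using assms
proof (induction "card A" arbitrary: A)
  case 0
  then show ?case by simp
next
  case (Suc n)
  then have ne: "A \<noteq> {}" by auto
  let ?m = "Max A"
  have m: "?m \<in> A" using Suc.prems(1) ne by (rule Max_in)
  have c: "card (A - {?m}) = n" using m Suc.hyps(2) Suc.prems(1) by simp
  have "A \<subseteq> {1..?m}" using Suc.prems by (auto simp: Suc_le_eq intro: gr0I)
  then have "card A \<le> ?m" using card_mono[of "{1..?m}" A] by simp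
  moreover have "\<Sum>{..n} \<le> \<Sum>(A - {?m})" using Suc.hyps(1)[of "A - {?m}"] Suc.prems c by simp
  moreover have "\<Sum>A = ?m + \<Sum>(A - {?m})" using m Suc.prems(1) by (simp add: sum.remove)
  moreover have "\<Sum>{..card A} = \<Sum>{..n} + card A" using Suc.hyps(2) by (metis sum.atMost_Suc)
  ultimately show ?case by linarith
qed

text \<open>The reflection \<open>a \<mapsto> k + 1 - a\<close> turns this into the lower bound for
  sums of distinct positive numbers.\<close>

lemma sum_bounded_set_le:
  fixes A :: "nat set"
  assumes "A \<subseteq> {1..k}"
  shows "\<Sum>A + \<Sum>{..card A} \<le> card A * (k + 1)"
proof -
  have fin: "finite A" using assms finite_subset by auto
  let ?r = "\<lambda>a. k + 1 - a"
  have inj: "inj_on ?r A" using assms by (auto simp: inj_on_def subset_iff)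
  have "\<Sum>{..card (?r ` A)} \<le> \<Sum>(?r ` A)" using assms fin by (intro sum_positive_set_ge) auto
  then have "\<Sum>{..card A} \<le> (\<Sum>a\<in>A. k + 1 - a)" using inj by (simp add: card_image sum.reindex)
  moreover have "(\<Sum>a\<in>A. k + 1 - a) + \<Sum>A = (\<Sum>a\<in>A. k + 1)"
    unfolding sum.distrib[symmetric] using assms by (intro sum.cong) auto
  ultimately show ?thesis by simp
qed

text \<open>What is left after deleting the edges from \<open>v\<close> to \<open>T\<close> and erasing the colours of \<open>v\<close> and of \<open>T\<close>:
  \<open>X u\<close> and \<open>Y w\<close> are the colours available for the edge \<open>{v, u}\<close> and for the vertex \<open>w\<close>, \<open>S w\<close> is the sum of the
  remaining edge colours at \<open>w\<close>, \<open>W w\<close> are the colour sums of its coloured neighbours, and \<open>U\<close> is the set of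
  remaining edge colours at \<open>v\<close>. The last conjunct holds because a colour sum at a vertex of degree 4
  is at most \<open>k + (k - 1) + \<dots> + (k - 4) = 5 k - 10\<close>.\<close>

definition star_data :: "'a set set \<Rightarrow> nat \<Rightarrow> 'a set \<Rightarrow> 'a \<Rightarrow> 'a set \<Rightarrow>
    ('a \<Rightarrow> nat set) \<Rightarrow> ('a \<Rightarrow> nat set) \<Rightarrow> ('a \<Rightarrow> nat) \<Rightarrow> ('a \<Rightarrow> nat set) \<Rightarrow> nat set \<Rightarrow> bool" where
  "star_data E k B v T X Y S W U \<longleftrightarrow>
    (\<forall>u. finite (X u) \<and> finite (Y u) \<and> finite (W u)) \<and>
    (\<forall>u\<in>T. k \<le> card (X u) + (degree E u - 1) + (degree E v - card T)) \<and>
    (\<forall>u\<in>T. k \<le> card (Y u) + 2 * (degree E u - 1)) \<and>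
    k \<le> card (Y v) + (degree E v - card T) + card (nbrs E v \<inter> B - T) \<and>
    Y v \<noteq> {} \<and>
    card (W v) \<le> card (nbrs E v \<inter> B - T) \<and>
    (\<forall>u\<in>T. card (W u) \<le> degree E u - 1) \<and>
    finite U \<and> card U = degree E v - card T \<and> S v = \<Sum>U \<and> 0 \<notin> U \<and> 0 \<notin> Y v \<and> Y v \<inter> U = {} \<and>
    (\<forall>u\<in>T. 0 \<notin> X u \<and> X u \<inter> U = {}) \<and>
    card {s \<in> W v. 5 * k < s + 10} \<le> card {u \<in> nbrs E v \<inter> B - T. degree E u \<noteq> 4}"

text \<open>\<open>h\<close> supplies the new vertex colours at \<open>v\<close> and at the leaves
  in \<open>B\<close>, and \<open>x u\<close> the colour of the edge from \<open>v\<close> to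
  \<open>u\<close>.\<close>

definition star_solution :: "'a set \<Rightarrow> 'a \<Rightarrow> 'a set \<Rightarrow>
    ('a \<Rightarrow> nat set) \<Rightarrow> ('a \<Rightarrow> nat set) \<Rightarrow> ('a \<Rightarrow> nat) \<Rightarrow> ('a \<Rightarrow> nat set) \<Rightarrow> ('a \<Rightarrow> nat) \<Rightarrow> ('a \<Rightarrow> nat) \<Rightarrow> bool" where
  "star_solution B v T X Y S W h x \<longleftrightarrow>
    inj_on x T \<and> (\<forall>u\<in>T. x u \<in> X u \<and> x u \<noteq> h v) \<and> h v \<in> Y v \<and> h v + S v + sum x T \<notin> W v \<and>
    (\<forall>u\<in>T \<inter> B. h u \<in> Y u \<and> x u \<noteq> h u \<and> h u \<noteq> h v \<and> h u + S u + x u \<notin> W u \<and>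
       h v + S v + sum x T \<noteq> h u + S u + x u)"

lemma card_avail:
  assumes "finite P"
  shows "k \<le> card ({1..k} - P) + card P"
  using diff_card_le_card_Diff[OF assms, of "{1..k}"] by simp

text \<open>Separates the graph from the choice of colours: a colouring without the star yields
  lists of guaranteed sizes, and solving the list problem \<open>comb\<close> is enough to colour
  the whole graph.\<close>

lemma star_reduction:
  assumes G: "simple_graph V E" and T: "T \<subseteq> nbrs E v" and v: "v \<in> B" and BV: "B \<subseteq> V"
    and small: "\<And>w. w \<in> V - B \<Longrightarrow> 3 * degree E w < k"
    and indep: "\<And>u w. u \<in> T \<inter> B \<Longrightarrow> w \<in> T \<inter> B \<Longrightarrow> {u, w} \<notin> E"
    and IH: "\<exists>f g. tnsd_colouring V (E - star v T) k f g"
    and comb: "\<And>X Y S W U. star_data E k B v T X Y S W U \<Longrightarrow> \<exists>h x. star_solution B v T X Y S W h x"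
  shows "\<exists>f g. tnsd_colouring V E k f g"
proof -
  let ?E = "E - star v T"
  have G': "simple_graph V ?E" using G by (rule simple_graph_subset) auto
  obtain f g where P: "partial_tnsd ?E k V f g" using IH partial_tnsd_iff[OF G'] by blast
  have vT: "v \<notin> T" using T not_self_nbr[OF G] by blast
  have finN: "finite (nbrs E w)" "finite (nbrs ?E w)" "finite (incident_edges ?E w)" for w
    using simple_graph_finite[OF G] simple_graph_finite[OF G'] by auto
  have finT: "finite T" using T finN finite_subset by blast
  have deg_v: "degree ?E v = degree E v - card T"
    unfolding degree_eq_card_nbrs[OF G] degree_eq_card_nbrs[OF G'] nbrs_delete_star_centre
    by (rule card_Diff_subset[OF finT T])
  have deg_u: "degree ?E u = degree E u - 1" if "u \<in> T" for u
  proof -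
    have "v \<in> nbrs E u" using T that nbrs_sym[of u E v] by auto
    then show ?thesis
      unfolding degree_eq_card_nbrs[OF G] degree_eq_card_nbrs[OF G'] nbrs_delete_star_leaf[OF that vT]
      by (rule card_Diff_singleton)
  qed
  define u where "u w = g ` incident_edges ?E w" for w
  define X where "X w = {1..k} - (u w \<union> u v)" for w
  define Y where "Y w = {1..k} - (u w \<union> f ` (nbrs ?E w \<inter> B))" for w
  define S where "S w = sum g (incident_edges ?E w)" for w
  define W where "W w = colour_sum ?E f g ` (nbrs ?E w \<inter> B)" for w
  have card_u: "finite (u w)" "card (u w) \<le> degree ?E w" for w
    unfolding u_def degree_def using finN by (auto simp: card_image_le)
  have inj_g: "inj_on g (incident_edges ?E w)" for w
  proof (rule inj_onI, rule ccontr)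
    fix e1 e2 assume e: "e1 \<in> incident_edges ?E w" "e2 \<in> incident_edges ?E w" "g e1 = g e2" "e1 \<noteq> e2"
    then have "e1 \<in> ?E" "e2 \<in> ?E" "e1 \<inter> e2 \<noteq> {}" unfolding incident_edges_def by auto
    then show False using partial_tnsdD(3)[OF P] e(3,4) by blast
  qed
  have nbrs_v: "nbrs ?E v \<inter> B = nbrs E v \<inter> B - T" unfolding nbrs_delete_star_centre by auto
  have data: "star_data E k B v T X Y S W (u v)"
    unfolding star_data_def
  proof (intro conjI ballI allI)
    fix w assume w: "w \<in> T"
    have "card (u w \<union> u v) \<le> (degree E w - 1) + (degree E v - card T)"
      using card_Un_le[of "u w" "u v"] card_u[of w] card_u[of v] deg_v deg_u[OF w] by linarith
    moreover have "k \<le> card (X w) + card (u w \<union> u v)" unfolding X_def using card_u by (intro card_avail) auto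
    ultimately show "k \<le> card (X w) + (degree E w - 1) + (degree E v - card T)" by linarith
    have nw: "card (nbrs ?E w \<inter> B) \<le> degree E w - 1"
      using deg_u[OF w] card_mono[of "nbrs ?E w" "nbrs ?E w \<inter> B"] finN degree_eq_card_nbrs[OF G', of w] by auto
    have "card (u w \<union> f ` (nbrs ?E w \<inter> B)) \<le> card (u w) + card (f ` (nbrs ?E w \<inter> B))" by (rule card_Un_le)
    also have "\<dots> \<le> (degree E w - 1) + (degree E w - 1)"
      using card_u(2)[of w] deg_u[OF w] card_image_le[of "nbrs ?E w \<inter> B" f] nw finN[of w] by (intro add_mono) auto
    finally have "card (u w \<union> f ` (nbrs ?E w \<inter> B)) \<le> 2 * (degree E w - 1)" by simp
    moreover have "k \<le> card (Y w) + card (u w \<union> f ` (nbrs ?E w \<inter> B))"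
      unfolding Y_def using card_u finN by (intro card_avail) auto
    ultimately show "k \<le> card (Y w) + 2 * (degree E w - 1)" by linarith
    show "card (W w) \<le> degree E w - 1"
      unfolding W_def using card_image_le[of "nbrs ?E w \<inter> B" "colour_sum ?E f g"] nw finN[of w] by auto
    show "0 \<notin> X w" "X w \<inter> u v = {}" unfolding X_def by auto
  next
    have "card (u v \<union> f ` (nbrs ?E v \<inter> B)) \<le> card (u v) + card (f ` (nbrs ?E v \<inter> B))" by (rule card_Un_le)
    also have "\<dots> \<le> (degree E v - card T) + card (nbrs ?E v \<inter> B)"
      using card_u(2)[of v] deg_v card_image_le[of "nbrs ?E v \<inter> B" f] finN[of v] by (intro add_mono) auto
    finally have "card (u v \<union> f ` (nbrs ?E v \<inter> B)) \<le> (degree E v - card T) + card (nbrs E v \<inter> B - T)"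
      unfolding nbrs_v .
    moreover have "k \<le> card (Y v) + card (u v \<union> f ` (nbrs ?E v \<inter> B))"
      unfolding Y_def using card_u finN by (intro card_avail) auto
    ultimately show "k \<le> card (Y v) + (degree E v - card T) + card (nbrs E v \<inter> B - T)" by linarith
    have vV: "v \<in> V" using v BV by auto
    \<comment> \<open>Counting may fail to show that a colour for \<open>v\<close> exists, but the
      old colour of \<open>v\<close> is still available.\<close>
    have "f v \<noteq> f w" if "w \<in> nbrs ?E v \<inter> B" for w
      using partial_tnsdD(5)[OF P vV, of w] that BV unfolding nbrs_def by auto
    moreover have "g e \<noteq> f v" if "e \<in> incident_edges ?E v" for e
      using partial_tnsdD(4)[OF P _ _ vV] that unfolding incident_edges_def by auto
    moreover have "f v \<in> {1..k}" using partial_tnsdD(1)[OF P vV] .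
    ultimately have "f v \<in> Y v" unfolding Y_def u_def by fastforce
    then show "Y v \<noteq> {}" by blast
    show "card (W v) \<le> card (nbrs E v \<inter> B - T)"
      unfolding W_def nbrs_v[symmetric] using finN by (simp add: card_image_le)
    show "finite (u v)" by (rule card_u)
    show "card (u v) = degree E v - card T"
      using card_image[OF inj_g, of v] deg_v unfolding u_def degree_def by simp
    show "S v = \<Sum>(u v)" unfolding S_def u_def by (simp add: sum.reindex inj_g)
    show "0 \<notin> u v" using partial_tnsdD(2)[OF P] unfolding u_def incident_edges_def by force
    show "0 \<notin> Y v" "Y v \<inter> u v = {}" unfolding Y_def by auto
    \<comment> \<open>Such a neighbour keeps its four edges. With its own colour these are five
      distinct colours, of sum at most \<open>5 * (k + 1) - 15\<close>.\<close>
    have le: "colour_sum ?E f g w + 10 \<le> 5 * k" if w: "w \<in> nbrs E v \<inter> B - T" "degree E w = 4" for w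
    proof -
      have "w \<noteq> v" using w not_self_nbr[OF G] by auto
      then have i: "incident_edges ?E w = incident_edges E w"
        using incident_delete_star_other[of w v T E] w by auto
      let ?A = "insert (f w) (u w)"
      have wV: "w \<in> V" using w BV by auto
      have "g e \<noteq> f w" if "e \<in> incident_edges ?E w" for e
        using partial_tnsdD(4)[OF P _ _ wV] that unfolding incident_edges_def by auto
      then have fu: "f w \<notin> u w" unfolding u_def by (metis imageE)
      have "card (u w) = 4" using w(2) i inj_g[of w] unfolding u_def degree_def by (simp add: card_image)
      then have cA: "card ?A = 5" using fu card_u(1) by simp
      have "\<Sum>?A = f w + \<Sum>(u w)" using fu card_u(1) by simp
      also have "\<Sum>(u w) = sum g (incident_edges ?E w)" unfolding u_def by (simp add: sum.reindex inj_g)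
      finally have sA: "\<Sum>?A = colour_sum ?E f g w" unfolding colour_sum_def by simp
      have "?A \<subseteq> {1..k}"
        using partial_tnsdD(1)[OF P wV] partial_tnsdD(2)[OF P] unfolding u_def incident_edges_def by auto
      then have "\<Sum>?A + \<Sum>{..card ?A} \<le> card ?A * (k + 1)" by (rule sum_bounded_set_le)
      moreover have "\<Sum>{..5::nat} = 15" by (simp add: numeral_eq_Suc)
      ultimately show ?thesis unfolding cA sA by simp
    qed
    have "{s \<in> W v. 5 * k < s + 10} \<subseteq> colour_sum ?E f g ` {w \<in> nbrs E v \<inter> B - T. degree E w \<noteq> 4}"
      unfolding W_def nbrs_v using le by (force simp: not_le[symmetric])
    then show "card {s \<in> W v. 5 * k < s + 10} \<le> card {w \<in> nbrs E v \<inter> B - T. degree E w \<noteq> 4}"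
      using finN by (intro surj_card_le) auto
  qed (auto simp: X_def Y_def W_def finN)
  from comb[OF this] obtain h x where sol: "star_solution B v T X Y S W h x" by blast
  have "\<exists>f' g'. partial_tnsd E k B f' g'"
  proof (rule reinsert_star[OF G T v indep])
    show "partial_tnsd ?E k (B - insert v (T \<inter> B)) f g" by (rule partial_tnsd_subset[OF P]) (use BV in auto)
    show "inj_on x T" using sol unfolding star_solution_def by blast
    show "x w \<in> {1..k} \<and> x w \<notin> g ` incident_edges ?E w \<and> x w \<notin> g ` incident_edges ?E v \<and> x w \<noteq> h v" if "w \<in> T" for w
      using sol that unfolding star_solution_def X_def u_def by blast
    show "x w \<noteq> h w \<and> h w \<noteq> h v" if "w \<in> T \<inter> B" for w
      using sol that unfolding star_solution_def by blast
    show "h w \<in> {1..k} \<and> h w \<notin> g ` incident_edges ?E w \<and> h w \<notin> f ` (nbrs ?E w \<inter> B)" if "w \<in> insert v (T \<inter> B)" for w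
    proof -
      have "h w \<in> Y w" using sol that unfolding star_solution_def by blast
      then show ?thesis unfolding Y_def u_def by blast
    qed
    show "h v + sum g (incident_edges ?E v) + sum x T \<notin> colour_sum ?E f g ` (nbrs ?E v \<inter> B)"
      using sol unfolding star_solution_def S_def W_def by blast
    show "h w + sum g (incident_edges ?E w) + x w \<notin> colour_sum ?E f g ` (nbrs ?E w \<inter> B)" if "w \<in> T \<inter> B" for w
      using sol that unfolding star_solution_def S_def W_def by blast
    show "h v + sum g (incident_edges ?E v) + sum x T \<noteq> h w + sum g (incident_edges ?E w) + x w" if "w \<in> T \<inter> B" for w
      using sol that unfolding star_solution_def S_def by blast
  qed
  then show ?thesis using extend_small[OF G _ BV small] partial_tnsd_iff[OF G] by blast
qed

section \<open>Excluded configurations\<close>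

lemma star_dataD:
  assumes "star_data E k B v T X Y S W U"
  shows "finite (X u)" "finite (Y u)" "finite (W u)"
    "u \<in> T \<Longrightarrow> k \<le> card (X u) + (degree E u - 1) + (degree E v - card T)"
    "u \<in> T \<Longrightarrow> k \<le> card (Y u) + 2 * (degree E u - 1)"
    "k \<le> card (Y v) + (degree E v - card T) + card (nbrs E v \<inter> B - T)"
    "Y v \<noteq> {}" "card (W v) \<le> card (nbrs E v \<inter> B - T)" "u \<in> T \<Longrightarrow> card (W u) \<le> degree E u - 1"
  using assms unfolding star_data_def by blast+

lemma star_dataD_used:
  assumes "star_data E k B v T X Y S W U"
  shows "finite U" "card U = degree E v - card T" "S v = \<Sum>U" "0 \<notin> U" "0 \<notin> Y v" "Y v \<inter> U = {}"
    "u \<in> T \<Longrightarrow> 0 \<notin> X u" "u \<in> T \<Longrightarrow> X u \<inter> U = {}"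
    "card {s \<in> W v. 5 * k < s + 10} \<le> card {u \<in> nbrs E v \<inter> B - T. degree E u \<noteq> 4}"
  using assms unfolding star_data_def by blast+

text \<open>The colour \<open>y\<close> of \<open>v\<close> is settled in advance, and only the
  edges to uncoloured leaves vary. \<open>W'\<close> may be smaller than \<open>W v\<close> when
  some forbidden sums cannot occur for other reasons.\<close>

lemma solve_fixed:
  assumes D: "star_data E k B v T X Y S W U" and y: "y \<in> Y v" and T: "T \<inter> B = {}" "finite T"
    and s: "surplus T (\<lambda>u. X u - {y}) e" and W': "finite W'" "card W' \<le> card T * e"
    and WW: "\<And>x. sdr T (\<lambda>u. X u - {y}) x \<Longrightarrow> y + S v + sum x T \<notin> W' \<Longrightarrow> y + S v + sum x T \<notin> W v"
  shows "\<exists>h x. star_solution B v T X Y S W h x"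
proof -
  obtain x where x: "sdr T (\<lambda>u. X u - {y}) x" "(y + S v) + sum x T \<notin> W'"
    using sdr_avoiding_sums[OF T(2) _ s W'] star_dataD(1)[OF D] by (metis finite_Diff)
  then have "star_solution B v T X Y S W (\<lambda>_. y) x"
    using y T(1) WW[of x] unfolding star_solution_def sdr_def by auto
  then show ?thesis by blast
qed

text \<open>The colour of \<open>v\<close> is a summand of its own sum and must differ from all star
  edges, so it acts as one more representative, with index \<open>v\<close> and list
  \<open>Y v\<close>.\<close>

lemma solve_free:
  assumes D: "star_data E k B v T X Y S W U" and T: "T \<inter> B = {}" "finite T" "v \<notin> T"
    and s: "surplus (insert v T) (X(v := Y v)) e" and W: "card (W v) \<le> (card T + 1) * e"
  shows "\<exists>h x. star_solution B v T X Y S W h x"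
proof -
  have "finite ((X(v := Y v)) i)" for i using star_dataD(1,2)[OF D] by auto
  moreover have "card (W v) \<le> card (insert v T) * e" using W T by simp
  ultimately obtain z where z: "sdr (insert v T) (X(v := Y v)) z" "S v + sum z (insert v T) \<notin> W v"
    using sdr_avoiding_sums[OF _ _ s star_dataD(3)[OF D, of v], of "S v"] T(2) by auto
  have zu: "z u \<in> X u" "z u \<noteq> z v" if "u \<in> T" for u
  proof -
    have "u \<noteq> v" using that T(3) by auto
    then show "z u \<in> X u" "z u \<noteq> z v" using that z(1) unfolding sdr_def inj_on_def by auto
  qed
  have "inj_on z T" "z v \<in> Y v" using z(1) unfolding sdr_def by auto
  moreover have "S v + sum z (insert v T) = z v + S v + sum z T" using T by simp
  then have "z v + S v + sum z T \<notin> W v" using z(2) by metis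
  ultimately have "star_solution B v T X Y S W (\<lambda>_. z v) z"
    using zu T(1) unfolding star_solution_def by auto
  then show ?thesis by blast
qed

locale minimal_counterexample =
  fixes V :: "'a set" and E :: "'a set set" and k :: nat
  assumes G: "simple_graph V E" and k: "11 \<le> k" and deg: "\<And>v. v \<in> V \<Longrightarrow> degree E v + 3 \<le> k"
    and uncolourable: "\<not> (\<exists>f g. tnsd_colouring V E k f g)"
    and colourable: "\<And>E'. E' \<subset> E \<Longrightarrow> \<exists>f g. tnsd_colouring V E' k f g"
begin

definition big :: "'a set" where
  "big = {v \<in> V. 4 \<le> degree E v}"

lemma nbrs_facts:
  "finite (nbrs E v)" "nbrs E v \<subseteq> V" "v \<notin> nbrs E v" "degree E v = card (nbrs E v)"
  using simple_graph_finite[OF G] not_self_nbr[OF G] degree_eq_card_nbrs[OF G] by auto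

lemma nbr_in_V: "u \<in> nbrs E v \<Longrightarrow> v \<in> V"
  using nbrs_facts(2)[of u] nbrs_sym[of u E v] by auto

lemma small_degree: "u \<in> nbrs E v - big \<Longrightarrow> degree E u \<le> 3"
  using nbrs_facts(2)[of v] unfolding big_def by auto

lemma degree_split: "degree E v = card (nbrs E v \<inter> big) + card (nbrs E v - big)"
  unfolding nbrs_facts(4) by (rule card_Int_Diff[OF nbrs_facts(1), of v big])

text \<open>The centre \<open>v\<close> counts as coloured even if its degree is at most 3, because
  it is recoloured together with the star.\<close>

lemma no_star_solution:
  assumes T: "T \<subseteq> nbrs E v" "T \<noteq> {}"
    and indep: "\<And>u w. u \<in> T \<inter> big \<Longrightarrow> w \<in> T \<inter> big \<Longrightarrow> {u, w} \<notin> E"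
    and sol: "\<And>X Y S W U. star_data E k (insert v big) v T X Y S W U \<Longrightarrow>
      \<exists>h x. star_solution (insert v big) v T X Y S W h x"
  shows False
proof -
  have vT: "v \<notin> T" using T nbrs_facts(3) by auto
  have vV: "v \<in> V" using T nbr_in_V by auto
  have "star v T \<subseteq> E" "star v T \<noteq> {}" using T unfolding nbrs_def by auto
  then have "E - star v T \<subset> E" by auto
  then have IH: "\<exists>f g. tnsd_colouring V (E - star v T) k f g" by (rule colourable)
  have "\<exists>f g. tnsd_colouring V E k f g"
  proof (rule star_reduction[OF G T(1) _ _ _ _ IH sol])
    show "insert v big \<subseteq> V" using vV unfolding big_def by auto
    show "3 * degree E w < k" if "w \<in> V - insert v big" for w
      using that k unfolding big_def by auto
    show "{u, w} \<notin> E" if "u \<in> T \<inter> insert v big" "w \<in> T \<inter> insert v big" for u w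
      using indep[of u w] that vT by auto
  qed auto
  then show False using uncolourable by blast
qed

text \<open>Only the edge \<open>{v, u}\<close> and the colour of \<open>v\<close> are chosen. If
  \<open>v\<close> had degree at most 5, at least 5 and 3 colours would be available: surplus 2 on
  two lists avoids the at most 4 sums at other neighbours.\<close>

lemma small_nbr_degree:
  assumes u: "u \<in> nbrs E v" "degree E u \<le> 3"
  shows "6 \<le> degree E v"
proof (rule ccontr)
  assume d: "\<not> 6 \<le> degree E v"
  have ub: "u \<notin> big" using u(2) unfolding big_def by auto
  have uv: "u \<noteq> v" using u(1) nbrs_facts(3) by auto
  show False
  proof (rule no_star_solution[of "{u}" v])
    fix X Y S W U assume D: "star_data E k (insert v big) v {u} X Y S W U"
    note DD = star_dataD[OF D]
    have c: "card (nbrs E v \<inter> insert v big - {u}) \<le> degree E v - 1"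
    proof -
      have "nbrs E v \<inter> insert v big - {u} \<subseteq> nbrs E v - {u}" by auto
      then have "card (nbrs E v \<inter> insert v big - {u}) \<le> card (nbrs E v - {u})"
        using nbrs_facts(1) by (intro card_mono) auto
      then show ?thesis using u(1) by (simp add: card_Diff_singleton nbrs_facts)
    qed
    have Y: "3 \<le> card (Y v)" using DD(6) c d k by simp
    have X: "5 \<le> card (X u)" using DD(4)[of u] u(2) d k by simp
    have "surplus ({} \<union> {v}) (X(v := Y v)) 2" by (rule surplus_Un) (use Y in \<open>auto simp: surplus_empty\<close>)
    then have "surplus ({v} \<union> {u}) (X(v := Y v)) 2"
      by (intro surplus_Un) (use X uv in auto)
    then have "surplus (insert v {u}) (X(v := Y v)) 2" by (simp add: insert_commute)
    then show "\<exists>h x. star_solution (insert v big) v {u} X Y S W h x"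
      by (rule solve_free[OF D, rotated -2]) (use ub uv DD(8) c d in auto)
  qed (use u ub in auto)
qed

text \<open>Here \<open>v\<close> keeps a colour chosen in advance. Only the big neighbours
  contribute forbidden sums, and surplus \<open>j\<close> on the lists of the small leaves would
  avoid them all.\<close>

lemma fixed_reduction:
  assumes T: "nbrs E v - big \<noteq> {}" and j: "degree E v + 3 + j \<le> k"
  shows "card (nbrs E v - big) * j < card (nbrs E v \<inter> big)"
proof (rule ccontr)
  let ?T = "nbrs E v - big"
  assume c: "\<not> ?thesis"
  show False
  proof (rule no_star_solution[of ?T v])
    fix X Y S W U assume D: "star_data E k (insert v big) v ?T X Y S W U"
    note DD = star_dataD[OF D]
    obtain y where y: "y \<in> Y v" using DD(7) by auto
    have fin: "finite ?T" using nbrs_facts(1) by auto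
    have "card ({} \<union> ?T) + j \<le> card (X u - {y})" if "u \<in> ?T" for u
    proof -
      have "card (X u) \<le> card (X u - {y}) + 1" using diff_card_le_card_Diff[of "{y}" "X u"] by simp
      then show ?thesis using DD(4)[OF that] small_degree[OF that] j degree_split[of v] by simp
    qed
    then have "surplus ({} \<union> ?T) (\<lambda>u. X u - {y}) j"
      by (intro surplus_Un) (use fin in \<open>auto simp: surplus_empty\<close>)
    moreover have "card (W v) \<le> card ?T * j"
    proof -
      have "nbrs E v \<inter> insert v big - ?T = nbrs E v \<inter> big" using nbrs_facts(3) by auto
      then show ?thesis using DD(8) c by simp
    qed
    ultimately show "\<exists>h x. star_solution (insert v big) v ?T X Y S W h x"
      by (intro solve_fixed[OF D y, where e = j and W' = "W v"]) (use fin DD(3) nbrs_facts(3) in auto)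
  qed (use T in auto)
qed

text \<open>The list of \<open>u0\<close> is larger by one, so \<open>u0\<close> may come last. The
  other lists then serve one index less, which raises the surplus from \<open>j\<close> to
  \<open>j + 1\<close> for all.\<close>

lemma fixed_reduction_2:
  assumes u0: "u0 \<in> nbrs E v" "degree E u0 \<le> 2" and j: "degree E v + 3 + j \<le> k"
    and y: "star_data E k (insert v big) v (nbrs E v - big) X Y S W U" "y \<in> Y v"
  shows "surplus (nbrs E v - big) (\<lambda>u. X u - {y}) (j + 1)"
proof -
  let ?T = "nbrs E v - big"
  have u0T: "u0 \<in> ?T" using u0 unfolding big_def by auto
  note DD = star_dataD[OF y(1)]
  have fin: "finite ?T" using nbrs_facts(1) by auto
  have cT: "card ?T = card (?T - {u0}) + 1" using u0T fin by (metis Suc_eq_plus1 card_Suc_Diff1)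
  have *: "card (X u) \<le> card (X u - {y}) + 1" for u using diff_card_le_card_Diff[of "{y}" "X u"] by simp
  have "card ({} \<union> (?T - {u0})) + (j + 1) \<le> card (X u - {y})" if "u \<in> ?T - {u0}" for u
  proof -
    have "u \<in> ?T" using that by auto
    then show ?thesis using DD(4)[of u] small_degree[of u v] j degree_split[of v] *[of u] cT by simp
  qed
  then have "surplus ({} \<union> (?T - {u0})) (\<lambda>u. X u - {y}) (j + 1)"
    by (intro surplus_Un) (use fin in \<open>auto simp: surplus_empty\<close>)
  then have 1: "surplus (?T - {u0}) (\<lambda>u. X u - {y}) (j + 1)" by simp
  have T: "(?T - {u0}) \<union> {u0} = ?T" using u0T by auto
  have "card ((?T - {u0}) \<union> {u0}) + (j + 1) \<le> card (X u0 - {y})"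
    unfolding T using DD(4)[OF u0T] u0(2) j degree_split[of v] *[of u0] by simp
  then have "surplus ((?T - {u0}) \<union> {u0}) (\<lambda>u. X u - {y}) (j + 1)"
    using 1 fin by (intro surplus_Un) auto
  then show ?thesis unfolding T .
qed

lemma fixed_reduction_2_bound:
  assumes u0: "u0 \<in> nbrs E v" "degree E u0 \<le> 2" and j: "degree E v + 3 + j \<le> k"
  shows "card (nbrs E v - big) * (j + 1) < card (nbrs E v \<inter> big)"
proof (rule ccontr)
  let ?T = "nbrs E v - big"
  assume c: "\<not> ?thesis"
  have u0T: "u0 \<in> ?T" using u0 unfolding big_def by auto
  show False
  proof (rule no_star_solution[of ?T v])
    fix X Y S W U assume D: "star_data E k (insert v big) v ?T X Y S W U"
    note DD = star_dataD[OF D]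
    obtain y where y: "y \<in> Y v" using DD(7) by auto
    have "nbrs E v \<inter> insert v big - ?T = nbrs E v \<inter> big" using nbrs_facts(3) by auto
    then have "card (W v) \<le> card ?T * (j + 1)" using DD(8) c by simp
    then show "\<exists>h x. star_solution (insert v big) v ?T X Y S W h x"
      by (intro solve_fixed[OF D y _ _ fixed_reduction_2[OF u0 j D y], where W' = "W v"])
        (use nbrs_facts DD(3) in auto)
  qed (use u0T in auto)
qed

text \<open>With \<open>t\<close> small leaves and at most one big neighbour, \<open>Y v\<close> has
  at least \<open>t + 2\<close> colours. So \<open>v\<close> can be the last representative after
  leaves with lists of size \<open>t + 1\<close>, and surplus 1 suffices for a single forbidden
  sum.\<close>

lemma free_reduction_few_big:
  assumes T: "nbrs E v - big \<noteq> {}"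
  shows "2 \<le> card (nbrs E v \<inter> big)"
proof (rule ccontr)
  let ?T = "nbrs E v - big"
  assume c: "\<not> ?thesis"
  show False
  proof (rule no_star_solution[of ?T v])
    fix X Y S W U assume D: "star_data E k (insert v big) v ?T X Y S W U"
    note DD = star_dataD[OF D]
    have vV: "v \<in> V" using T nbr_in_V by auto
    have fin: "finite ?T" "v \<notin> ?T" using nbrs_facts by auto
    have N: "nbrs E v \<inter> insert v big - ?T = nbrs E v \<inter> big" using nbrs_facts(3) by auto
    have "card ({} \<union> ?T) + 1 \<le> card ((X(v := Y v)) u)" if u: "u \<in> ?T" for u
      using DD(4)[OF u] small_degree[OF u] deg[OF vV] degree_split[of v] u fin(2) by auto
    then have "surplus ({} \<union> ?T) (X(v := Y v)) 1"
      by (intro surplus_Un) (use fin in \<open>auto simp: surplus_empty\<close>)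
    then have 1: "surplus ?T (X(v := Y v)) 1" by simp
    have "card (?T \<union> {v}) + 1 \<le> card (Y v)"
      using DD(6) c deg[OF vV] degree_split[of v] fin unfolding N by simp
    then have "surplus (?T \<union> {v}) (X(v := Y v)) 1" using 1 fin by (intro surplus_Un) auto
    then have "surplus (insert v ?T) (X(v := Y v)) 1" by simp
    then show "\<exists>h x. star_solution (insert v big) v ?T X Y S W h x"
      by (rule solve_free[OF D, rotated -2]) (use fin DD(8) N c in auto)
  qed (use T in auto)
qed

text \<open>Now \<open>v\<close> comes first in the order and needs only two colours. The leaves
  follow and need lists of size \<open>t + 2\<close>, with \<open>t\<close> the number of small
  leaves; the extra colour from \<open>1 \<le> j\<close> provides this.\<close>

lemma free_reduction:
  assumes T: "nbrs E v - big \<noteq> {}" and j: "degree E v + 3 + j \<le> k" and j1: "1 \<le> j"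
  shows "card (nbrs E v - big) + 2 \<le> card (nbrs E v \<inter> big)"
proof (rule ccontr)
  let ?T = "nbrs E v - big"
  assume c: "\<not> ?thesis"
  show False
  proof (rule no_star_solution[of ?T v])
    fix X Y S W U assume D: "star_data E k (insert v big) v ?T X Y S W U"
    note DD = star_dataD[OF D]
    have fin: "finite ?T" "v \<notin> ?T" using nbrs_facts by auto
    have N: "nbrs E v \<inter> insert v big - ?T = nbrs E v \<inter> big" using nbrs_facts(3) by auto
    have "surplus ({} \<union> {v}) (X(v := Y v)) 1"
      by (rule surplus_Un) (use DD(6) c j j1 degree_split[of v] N in \<open>auto simp: surplus_empty\<close>)
    then have 1: "surplus {v} (X(v := Y v)) 1" by simp
    have "card ({v} \<union> ?T) + 1 \<le> card ((X(v := Y v)) u)" if u: "u \<in> ?T" for u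
      using DD(4)[OF u] small_degree[OF u] j j1 degree_split[of v] u fin by auto
    then have "surplus ({v} \<union> ?T) (X(v := Y v)) 1" using 1 fin by (intro surplus_Un) auto
    then have "surplus (insert v ?T) (X(v := Y v)) 1" by simp
    then show "\<exists>h x. star_solution (insert v big) v ?T X Y S W h x"
      by (rule solve_free[OF D, rotated -2]) (use fin DD(8) N c in auto)
  qed (use T in auto)
qed

text \<open>Without an extra colour the order is \<open>v\<close>, then the other small leaves with
  lists of size at least \<open>t + 1\<close>, and finally \<open>u0\<close>, whose list has at
  least \<open>t + 2\<close> colours because of its smaller degree; here \<open>t\<close> counts the
  small leaves.\<close>

lemma free_reduction_2:
  assumes u0: "u0 \<in> nbrs E v" "degree E u0 \<le> 2"
  shows "card (nbrs E v - big) + 2 \<le> card (nbrs E v \<inter> big)"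
proof (rule ccontr)
  let ?T = "nbrs E v - big"
  assume c: "\<not> ?thesis"
  have u0T: "u0 \<in> ?T" using u0 unfolding big_def by auto
  show False
  proof (rule no_star_solution[of ?T v])
    fix X Y S W U assume D: "star_data E k (insert v big) v ?T X Y S W U"
    note DD = star_dataD[OF D]
    have vV: "v \<in> V" using u0 nbr_in_V by auto
    have fin: "finite ?T" "v \<notin> ?T" using nbrs_facts by auto
    have N: "nbrs E v \<inter> insert v big - ?T = nbrs E v \<inter> big" using nbrs_facts(3) by auto
    have cT: "card ?T = card (?T - {u0}) + 1" using u0T fin by (metis Suc_eq_plus1 card_Suc_Diff1)
    have "surplus ({} \<union> {v}) (X(v := Y v)) 1"
      by (rule surplus_Un) (use DD(6) c deg[OF vV] degree_split[of v] N in \<open>auto simp: surplus_empty\<close>)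
    then have 1: "surplus {v} (X(v := Y v)) 1" by simp
    have c1: "card ({v} \<union> (?T - {u0})) = card ?T" using cT fin by simp
    have "card ({v} \<union> (?T - {u0})) + 1 \<le> card ((X(v := Y v)) u)" if u: "u \<in> ?T - {u0}" for u
    proof -
      have u': "u \<in> ?T" "u \<noteq> v" using u fin by auto
      show ?thesis using DD(4)[OF u'(1)] small_degree[OF u'(1)] deg[OF vV] degree_split[of v] u'(2)
        unfolding c1 by simp
    qed
    then have 2: "surplus ({v} \<union> (?T - {u0})) (X(v := Y v)) 1" using 1 fin by (intro surplus_Un) auto
    have TT: "({v} \<union> (?T - {u0})) \<union> {u0} = insert v ?T" using u0T by auto
    have "u0 \<noteq> v" using u0T fin by auto
    then have "card (insert v ?T) + 1 \<le> card ((X(v := Y v)) u0)"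
      using DD(4)[OF u0T] u0(2) deg[OF vV] degree_split[of v] fin by simp
    then have "card (({v} \<union> (?T - {u0})) \<union> {u0}) + 1 \<le> card ((X(v := Y v)) i)" if "i \<in> {u0}" for i
      using that unfolding TT by simp
    then have "surplus (({v} \<union> (?T - {u0})) \<union> {u0}) (X(v := Y v)) 1"
      by (rule surplus_Un[OF _ _ 2, rotated -1]) (use fin in auto)
    then have "surplus (insert v ?T) (X(v := Y v)) 1" unfolding TT .
    then show "\<exists>h x. star_solution (insert v big) v ?T X Y S W h x"
      by (rule solve_free[OF D, rotated -2]) (use fin DD(8) N c in auto)
  qed (use u0T in auto)
qed

section \<open>Configurations with a neighbour of degree 4\<close>

lemma degree_4_big: "u \<in> nbrs E v \<Longrightarrow> degree E u = 4 \<Longrightarrow> u \<in> nbrs E v \<inter> big"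
  using nbrs_facts(2)[of v] unfolding big_def by auto

lemma card_big_nbrs_Diff:
  assumes "u \<in> nbrs E v" "degree E u = 4" "T \<subseteq> nbrs E v - big"
  shows "card (nbrs E v \<inter> insert v big - insert u T) + 1 = card (nbrs E v \<inter> big)"
proof -
  have "nbrs E v \<inter> insert v big - insert u T = nbrs E v \<inter> big - {u}" using nbrs_facts(3) assms(3) by auto
  moreover have "u \<in> nbrs E v \<inter> big" using assms degree_4_big by auto
  ultimately show ?thesis using card_Suc_Diff1[of "nbrs E v \<inter> big" u] nbrs_facts(1)[of v] by simp
qed

text \<open>Degree at most 3 for \<open>v\<close> contradicts \<open>small_nbr_degree\<close> seen
  from \<open>u\<close>. Two adjacent 4-vertices are excluded by recolouring their common edge and
  both ends.\<close>

lemma nbr_degree_4: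
  assumes u: "u \<in> nbrs E v" "degree E u = 4"
  shows "5 \<le> degree E v"
proof (rule ccontr)
  assume "\<not> ?thesis"
  moreover have "\<not> degree E v \<le> 3" using small_nbr_degree[of v u] nbrs_sym[of u E v] u by auto
  ultimately have d: "degree E v = 4" by simp
  have uv: "u \<noteq> v" using u(1) nbrs_facts(3) by auto
  have ub: "u \<in> big" using degree_4_big[OF u] by auto
  show False
  proof (rule no_star_solution[of "{u}" v])
    show "{a, b} \<notin> E" if "a \<in> {u} \<inter> big" "b \<in> {u} \<inter> big" for a b
      using that nbrs_facts(3)[of u] unfolding nbrs_def by auto
    fix X Y S W U assume D: "star_data E k (insert v big) v {u} X Y S W U"
    note DD = star_dataD[OF D]
    have c: "card (nbrs E v \<inter> insert v big - {u}) \<le> 3"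
      using card_big_nbrs_Diff[OF u, of "{}"] degree_split[of v] d by simp
    have 1: "5 \<le> card (X u)" "5 \<le> card (Y v)" "3 \<le> card (Y u)" "card (W u) \<le> 3" "card (W v) \<le> 3"
      using DD(4-6,8,9) u(2) d k c by auto
    obtain a y f where s: "a \<in> X u" "y \<in> Y v" "f \<in> Y u" "a \<noteq> y" "a \<noteq> f" "y \<noteq> f"
      "S u + a + f \<notin> W u" "S v + a + y \<notin> W v" "S u + f \<noteq> S v + y"
      by (rule colours_4_4[OF 1(1-3) DD(3) 1(4) DD(3) 1(5), of "S u" "S v"])
    have "star_solution (insert v big) v {u} X Y S W ((\<lambda>_. y)(u := f)) (\<lambda>_. a)"
      unfolding star_solution_def using s uv ub by (simp add: add_ac)
    then show "\<exists>h x. star_solution (insert v big) v {u} X Y S W h x" by blast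
  qed (use u in auto)
qed

text \<open>Both 4-vertices are recoloured at once, together with \<open>v\<close>. By
  \<open>nbr_degree_4\<close> they are not adjacent, as required of coloured leaves of a
  star.\<close>

lemma degree_5_nbrs:
  assumes d: "degree E v = 5" and u: "u \<in> nbrs E v" "degree E u = 4" and t: "t \<in> nbrs E v" "degree E t = 4"
  shows "u = t"
proof (rule ccontr)
  assume ut: "u \<noteq> t"
  have uv: "u \<noteq> v" "t \<noteq> v" using u(1) t(1) nbrs_facts(3) by auto
  have ub: "u \<in> big" "t \<in> big" using degree_4_big u t by auto
  have nonadj: "{u, t} \<notin> E" using nbr_degree_4[of u t] u t unfolding nbrs_def by (auto simp: insert_commute)
  show False
  proof (rule no_star_solution[of "{u, t}" v])
    show "{a, b} \<notin> E" if "a \<in> {u, t} \<inter> big" "b \<in> {u, t} \<inter> big" for a b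
      using that nbrs_facts(3)[of u] nbrs_facts(3)[of t] nonadj unfolding nbrs_def by (auto simp: insert_commute)
    fix X Y S W U assume D: "star_data E k (insert v big) v {u, t} X Y S W U"
    note DD = star_dataD[OF D]
    have "nbrs E v \<inter> insert v big - {u, t} \<subseteq> nbrs E v - {u, t}" by auto
    then have "card (nbrs E v \<inter> insert v big - {u, t}) \<le> card (nbrs E v - {u, t})"
      using nbrs_facts(1) by (intro card_mono) auto
    also have "\<dots> = card (nbrs E v) - card {u, t}" using u t by (intro card_Diff_subset) auto
    finally have c: "card (nbrs E v \<inter> insert v big - {u, t}) \<le> 3"
      using d ut nbrs_facts(4)[of v] by simp
    have cT: "card {u, t} = 2" using ut by simp
    have 1: "5 \<le> card (X u)" "5 \<le> card (X t)" "5 \<le> card (Y v)" "3 \<le> card (Y u)" "5 \<le> card (Y t)"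
      "card (W u) \<le> 3" "card (W t) \<le> 3" "card (W v) \<le> 3"
      using DD(4,5,9)[of u] DD(4,5,9)[of t] DD(6,8) u(2) t(2) d k c cT by auto
    obtain a b y f g where s: "a \<in> X u" "b \<in> X t" "y \<in> Y v" "f \<in> Y u" "g \<in> Y t"
      "a \<noteq> b" "a \<noteq> y" "b \<noteq> y" "a \<noteq> f" "b \<noteq> g" "y \<noteq> f" "y \<noteq> g"
      "S u + a + f \<notin> W u" "S t + b + g \<notin> W t" "S v + a + b + y \<notin> W v"
      "S u + f \<noteq> S v + b + y" "S t + g \<noteq> S v + a + y"
      by (rule colours_5[OF 1(1-5) DD(3) 1(6) DD(3) 1(7) DD(3) 1(8), of "S u" "S t" "S v"])
    have "star_solution (insert v big) v {u, t} X Y S W ((\<lambda>_. y)(u := f, t := g)) ((\<lambda>_. a)(t := b))"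
      unfolding star_solution_def using s uv ub ut by (simp add: add_ac)
    then show "\<exists>h x. star_solution (insert v big) v {u, t} X Y S W h x" by blast
  qed (use u t in auto)
qed

text \<open>The star takes the 4-vertex and just one small leaf. The guaranteed list sizes 5, 4, 3
  and 5 give total exponent 13, the number of constraints.\<close>

lemma degree_6_nbrs:
  assumes d: "degree E v = 6" and w: "w \<in> nbrs E v" "degree E w \<le> 3"
    and u: "u \<in> nbrs E v" "degree E u = 4"
  shows False
proof -
  have uv: "u \<noteq> v" "w \<noteq> v" "u \<noteq> w" using u w nbrs_facts(3) by auto
  have ub: "u \<in> big" "w \<notin> big" using degree_4_big[OF u] w unfolding big_def by auto
  show False
  proof (rule no_star_solution[of "{u, w}" v])
    show "{a, b} \<notin> E" if "a \<in> {u, w} \<inter> big" "b \<in> {u, w} \<inter> big" for a b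
      using that ub nbrs_facts(3)[of u] unfolding nbrs_def by auto
    fix X Y S W U assume D: "star_data E k (insert v big) v {u, w} X Y S W U"
    note DD = star_dataD[OF D]
    have "nbrs E v - big \<noteq> {}" using w ub by auto
    then have "1 \<le> card (nbrs E v - big)" using nbrs_facts(1)[of v] by (simp add: Suc_le_eq card_gt_0_iff)
    then have c: "card (nbrs E v \<inter> insert v big - {u, w}) \<le> 4"
      using card_big_nbrs_Diff[OF u, of "{w}"] degree_split[of v] d w ub by simp
    have cT: "card {u, w} = 2" using uv by simp
    have 1: "5 \<le> card (X w)" "4 \<le> card (X u)" "3 \<le> card (Y v)" "5 \<le> card (Y u)"
      "card (W u) \<le> 3" "card (W v) \<le> 4"
      using DD(4,5,9)[of u] DD(4)[of w] DD(6,8) u(2) w(2) d k c cT by auto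
    obtain x a y f where s: "x \<in> X w" "a \<in> X u" "y \<in> Y v" "f \<in> Y u"
      "x \<noteq> a" "x \<noteq> y" "a \<noteq> y" "a \<noteq> f" "y \<noteq> f"
      "S u + a + f \<notin> W u" "S v + x + a + y \<notin> W v" "S u + f \<noteq> S v + x + y"
      by (rule colours_6[OF 1(1-4) DD(3) 1(5) DD(3) 1(6), of "S u" "S v"])
    have "star_solution (insert v big) v {u, w} X Y S W ((\<lambda>_. y)(u := f)) ((\<lambda>_. x)(u := a))"
      unfolding star_solution_def using s uv ub by (simp add: add_ac)
    then show "\<exists>h x. star_solution (insert v big) v {u, w} X Y S W h x" by blast
  qed (use u w in auto)
qed

text \<open>The colour \<open>y\<close> of \<open>v\<close> is fixed first: it leaves the four lists
  and joins the constant \<open>S v\<close>. The degree of \<open>w\<close> makes its list large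
  enough for the 12 constraints.\<close>

lemma degree_7_nbrs:
  assumes d: "degree E v = 7" and t: "card (nbrs E v - big) = 2"
    and w: "w \<in> nbrs E v" "degree E w \<le> 2" and u: "u \<in> nbrs E v" "degree E u = 4"
  shows False
proof -
  have ub: "u \<in> big" "w \<notin> big" using degree_4_big[OF u] w unfolding big_def by auto
  have "w \<in> nbrs E v - big" using w ub by auto
  then have "card (nbrs E v - big - {w}) = 1" using t nbrs_facts(1)[of v] by simp
  then obtain z where z: "nbrs E v - big - {w} = {z}" by (rule card_1_singletonE)
  then have z: "z \<in> nbrs E v - big" "z \<noteq> w" by auto
  have uv: "u \<noteq> v" "w \<noteq> v" "z \<noteq> v" "u \<noteq> w" "u \<noteq> z" using u w z ub nbrs_facts(3) by auto
  show False
  proof (rule no_star_solution[of "{u, w, z}" v])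
    show "{a, b} \<notin> E" if "a \<in> {u, w, z} \<inter> big" "b \<in> {u, w, z} \<inter> big" for a b
      using that ub z nbrs_facts(3)[of u] unfolding nbrs_def by auto
    fix X Y S W U assume D: "star_data E k (insert v big) v {u, w, z} X Y S W U"
    note DD = star_dataD[OF D]
    have c: "card (nbrs E v \<inter> insert v big - {u, w, z}) \<le> 4"
      using card_big_nbrs_Diff[OF u, of "{w, z}"] degree_split[of v] d w z ub t by simp
    have cT: "card {u, w, z} = 3" using uv z by simp
    obtain y where y: "y \<in> Y v" using DD(7) by auto
    have rem: "card P \<le> card (P - {y}) + 1" for P using diff_card_le_card_Diff[of "{y}" P] by simp
    have 1: "5 \<le> card (X w - {y})" "4 \<le> card (X z - {y})" "3 \<le> card (X u - {y})" "4 \<le> card (Y u - {y})"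
      "card (W u) \<le> 3" "card (W v) \<le> 4"
      using DD(4,5,9)[of u] DD(4)[of w] DD(4)[of z] DD(8) u(2) w(2) small_degree[OF z(1)] d k c cT
        rem[of "X w"] rem[of "X z"] rem[of "X u"] rem[of "Y u"] by auto
    obtain p q a f where s: "p \<in> X w - {y}" "q \<in> X z - {y}" "a \<in> X u - {y}" "f \<in> Y u - {y}"
      "p \<noteq> q" "p \<noteq> a" "q \<noteq> a" "a \<noteq> f"
      "S u + a + f \<notin> W u" "(S v + y) + p + q + a \<notin> W v" "S u + f \<noteq> (S v + y) + p + q"
      by (rule colours_7[OF 1(1-4) DD(3) 1(5) DD(3) 1(6), of "S u" "S v + y"])
    have "star_solution (insert v big) v {u, w, z} X Y S W ((\<lambda>_. y)(u := f)) ((\<lambda>_. p)(u := a, z := q))"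
      unfolding star_solution_def using s uv z ub y by (simp add: add_ac)
    then show "\<exists>h x. star_solution (insert v big) v {u, w, z} X Y S W h x" by blast
  qed (use u w z in auto)
qed

text \<open>For \<open>k = 11\<close> a vertex of degree 8 has sum at least \<open>1 + \<dots> + 9 = 45\<close>, one of degree 4 at most
  \<open>7 + \<dots> + 11 = 45\<close>. Avoiding the single value 45 at \<open>v\<close> thus deals with all neighbours of degree 4.\<close>

lemma degree_8_nbrs_2:
  assumes d: "degree E v = 8" and t: "card (nbrs E v - big) = 3" and u0: "u0 \<in> nbrs E v" "degree E u0 \<le> 2"
  shows "card {u \<in> nbrs E v. degree E u = 4} \<le> 2"
proof (rule ccontr)
  let ?T = "nbrs E v - big" and ?Q = "{u \<in> nbrs E v. degree E u = 4}"
  assume q: "\<not> ?thesis"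
  have b: "card (nbrs E v \<inter> big) = 5" using degree_split[of v] d t by simp
  \<comment> \<open>With one more colour, three lists of surplus 2 would avoid 6 sums, and there are
    only 5 big neighbours.\<close>
  have k11: "k = 11"
  proof (rule ccontr)
    assume "k \<noteq> 11"
    then have "card ?T * (1 + 1) < card (nbrs E v \<inter> big)"
      by (intro fixed_reduction_2_bound[OF u0]) (use d k in auto)
    then show False using b t by simp
  qed
  have u0T: "u0 \<in> ?T" using u0 unfolding big_def by auto
  show False
  proof (rule no_star_solution[of ?T v])
    fix X Y S W U assume D: "star_data E k (insert v big) v ?T X Y S W U"
    note DD = star_dataD[OF D] and DU = star_dataD_used[OF D]
    obtain y where y: "y \<in> Y v" using DD(7) by auto
    \<comment> \<open>Sums above 45 can come only from the at most two big neighbours whose degree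
      is not 4. Together with 45 itself these are 3 values, just what three lists of surplus 1
      avoid.\<close>
    let ?W = "insert 45 {s \<in> W v. 5 * k < s + 10}"
    have sur: "surplus ?T (\<lambda>u. X u - {y}) (0 + 1)"
      by (rule fixed_reduction_2[OF u0 _ D y]) (use d k in auto)
    have "{u \<in> nbrs E v \<inter> insert v big - ?T. degree E u \<noteq> 4} = nbrs E v \<inter> big - ?Q"
      using nbrs_facts(3)[of v] by auto
    moreover have "?Q \<subseteq> nbrs E v \<inter> big" using degree_4_big by auto
    moreover have finQ: "finite ?Q" using nbrs_facts(1)[of v] by auto
    ultimately have "card {u \<in> nbrs E v \<inter> insert v big - ?T. degree E u \<noteq> 4} = 5 - card ?Q"
      using b by (simp add: card_Diff_subset)
    then have "card {s \<in> W v. 5 * k < s + 10} \<le> 2" using DU(9) q by simp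
    then have cW: "card ?W \<le> card ?T * (0 + 1)"
      using t card_insert_le_m1[of 3 "{s \<in> W v. 5 * k < s + 10}" 45] by simp
    show "\<exists>h x. star_solution (insert v big) v ?T X Y S W h x"
    proof (rule solve_fixed[OF D y _ _ sur _ cW])
      fix x assume x: "sdr ?T (\<lambda>u. X u - {y}) x" and nW: "y + S v + sum x ?T \<notin> ?W"
      have fin: "finite ?T" using nbrs_facts(1) by auto
      have xT: "x u \<in> X u" "x u \<noteq> y" if "u \<in> ?T" for u using x that unfolding sdr_def by auto
      have dis: "x ` ?T \<inter> U = {}" "y \<notin> U \<union> x ` ?T" "0 \<notin> x ` ?T"
        using xT DU(8) y DU(6) DU(7) by (blast, blast, metis imageE)
      have cx: "card (x ` ?T) = 3" using x t unfolding sdr_def by (simp add: card_image)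
      have cU: "card U = 5" using DU(2) d t by simp
      let ?A = "insert y (U \<union> x ` ?T)"
      have sx: "\<Sum>(x ` ?T) = sum x ?T" using x unfolding sdr_def by (simp add: sum.reindex)
      have "card (U \<union> x ` ?T) = 8" using dis cx cU DU(1) fin by (subst card_Un_disjoint) auto
      then have "card ?A = 9" using dis DU(1) fin by simp
      moreover have "\<Sum>(U \<union> x ` ?T) = S v + sum x ?T"
        using dis DU(1,3) fin sx by (subst sum.union_disjoint) auto
      then have "\<Sum>?A = y + S v + sum x ?T" using dis DU(1) fin by simp
      moreover have "0 \<notin> ?A" using dis DU(4,5) y by auto
      then have "\<Sum>{..card ?A} \<le> \<Sum>?A" using DU(1) fin by (intro sum_positive_set_ge) auto
      moreover have "\<Sum>{..9::nat} = 45" by (simp add: numeral_eq_Suc)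
      ultimately have "45 \<le> y + S v + sum x ?T" by metis
      then have "5 * k < y + S v + sum x ?T + 10" using nW k11 by simp
      then show "y + S v + sum x ?T \<notin> W v" using nW by blast
    qed (use DD(3) nbrs_facts in auto)
  qed (use u0T in auto)
qed

text \<open>A greedy choice suffices. For an arbitrary colour \<open>y\<close> of \<open>v\<close>
  and \<open>a\<close> of the edge to \<open>u\<close>, six lists of size 8 would keep 6 colours and
  have no surplus. Since \<open>Y v\<close> has at least 9 colours, \<open>y\<close> can be taken
  outside 8 colours of one list; that list then loses only \<open>a\<close>, and the surplus becomes
  1.\<close>

lemma degree_8_nbrs_3:
  assumes d: "degree E v = 8" and t: "card (nbrs E v - big) = 6" and u: "u \<in> nbrs E v" "degree E u = 4"
  shows False
proof -
  let ?T = "nbrs E v - big"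
  have b: "card (nbrs E v \<inter> big) = 2" using degree_split[of v] d t by simp
  have Tne: "?T \<noteq> {}" using t by (intro notI) (simp only: card.empty)
  have k11: "k = 11"
  proof (rule ccontr)
    assume "k \<noteq> 11"
    then have "card ?T * 1 < card (nbrs E v \<inter> big)"
      by (intro fixed_reduction[OF Tne]) (use d k in auto)
    then show False using b t by simp
  qed
  have ub: "u \<in> big" "u \<notin> ?T" using degree_4_big[OF u] by auto
  have uv: "u \<noteq> v" using u nbrs_facts(3) by auto
  have fin: "finite ?T" "v \<notin> ?T" using nbrs_facts by auto
  show False
  proof (rule no_star_solution[of "insert u ?T" v])
    show "{a, b} \<notin> E" if "a \<in> insert u ?T \<inter> big" "b \<in> insert u ?T \<inter> big" for a b
      using that nbrs_facts(3)[of u] unfolding nbrs_def by auto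
    fix X Y S W U assume D: "star_data E k (insert v big) v (insert u ?T) X Y S W U"
    note DD = star_dataD[OF D]
    have c: "card (nbrs E v \<inter> insert v big - insert u ?T) = 1"
      using card_big_nbrs_Diff[OF u, of ?T] b by simp
    have cT: "card (insert u ?T) = 7" using ub fin t by simp
    have cX: "8 \<le> card (X w)" if "w \<in> ?T" for w
      using DD(4)[of w] small_degree[OF that] that d cT k by auto
    have cX4: "7 \<le> card (X u)" using DD(4)[of u] u(2) d cT k by auto
    have cY: "9 \<le> card (Y v)" using DD(6) d cT c k by auto
    have cYu: "5 \<le> card (Y u)" using DD(5)[of u] u(2) k by auto
    have cW: "card (W v) \<le> 1" "card (W u) \<le> 3" using DD(8) DD(9)[of u] c u(2) by auto
    obtain w where w: "w \<in> ?T" using Tne by auto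
    obtain X1 where X1: "X1 \<subseteq> X w" "card X1 = 8" using cX[OF w] by (meson obtain_subset_with_card_n)
    have finX1: "finite X1" using X1(1) DD(1) finite_subset by blast
    have pick: "\<exists>p. p \<in> P \<and> p \<notin> Q" if "card Q < card P" "finite Q" for P Q :: "nat set"
      using that by (metis card_mono not_le subsetI)
    obtain y where y: "y \<in> Y v" "y \<notin> X1" using pick[of X1 "Y v"] X1(2) cY finX1 by auto
    obtain f where f: "f \<in> Y u" "f \<noteq> y" using pick[of "{y}" "Y u"] cYu by auto
    \<comment> \<open>The last set keeps the sum at \<open>u\<close> away from its other neighbours.
      At most 5 values are excluded, fewer than the 7 colours of \<open>X u\<close>.\<close>
    let ?bad = "insert y (insert f ((\<lambda>s. s - (f + S u)) ` W u))"
    have "card ?bad \<le> 5"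
    proof -
      have "card ((\<lambda>s. s - (f + S u)) ` W u) \<le> 3" using card_image_le[OF DD(3)[of u]] cW(2) order.trans by blast
      then show ?thesis using DD(3)[of u] by (simp add: card_insert_if)
    qed
    then obtain a where a: "a \<in> X u" "a \<notin> ?bad" using pick[of ?bad "X u"] cX4 DD(3)[of u] by auto
    have aW: "f + S u + a \<notin> W u" using a(2) by force
    let ?A = "\<lambda>i. (if i = w then X1 else X i) - {y, a}"
    have cT1: "card (?T - {w}) = 5" using w t fin by simp
    have "card ({} \<union> (?T - {w})) + 1 \<le> card (?A i)" if i: "i \<in> ?T - {w}" for i
    proof -
      have "card (X i) - card {y, a} \<le> card (X i - {y, a})" by (rule diff_card_le_card_Diff) simp
      moreover have "card {y, a} \<le> 2" by (simp add: card_insert_if)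
      ultimately show ?thesis using cX[of i] i cT1 by auto
    qed
    then have "surplus ({} \<union> (?T - {w})) ?A 1"
      by (rule surplus_Un[OF _ _ surplus_empty, rotated -1]) (use fin in auto)
    then have s1: "surplus (?T - {w}) ?A 1" by simp
    have TT: "(?T - {w}) \<union> {w} = ?T" using w by auto
    have "card ((?T - {w}) \<union> {w}) + 1 \<le> card (?A i)" if "i \<in> {w}" for i
    proof -
      have "?A i = X1 - {a}" using that y(2) by auto
      then show ?thesis using diff_card_le_card_Diff[of "{a}" X1] X1(2) t unfolding TT by simp
    qed
    then have "surplus ((?T - {w}) \<union> {w}) ?A 1" by (rule surplus_Un[OF _ _ s1, rotated -1]) (use fin in auto)
    then have sur: "surplus ?T ?A 1" unfolding TT .
    have finA: "finite (?A i)" for i using finX1 DD(1) by auto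
    \<comment> \<open>The sum at \<open>u\<close> is already determined, so it simply joins the
      forbidden sums at \<open>v\<close>.\<close>
    have "card (insert (f + S u + a) (W v)) \<le> card ?T * 1"
      using cW(1) t DD(3)[of v] by (simp add: card_insert_if)
    then obtain x where x: "sdr ?T ?A x" "(y + S v + a) + sum x ?T \<notin> insert (f + S u + a) (W v)"
      using sdr_avoiding_sums[OF fin(1) finA sur, of "insert (f + S u + a) (W v)" "y + S v + a"] DD(3)[of v] by auto
    let ?x = "x(u := a)" and ?h = "(\<lambda>_. y)(u := f)"
    have xT: "x i \<in> X i" "x i \<noteq> y" "x i \<noteq> a" if "i \<in> ?T" for i
      using x(1) that X1(1) unfolding sdr_def by (auto split: if_splits)
    have same: "?x i = x i" if "i \<in> ?T" for i using that ub(2) by auto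
    have "sum ?x (insert u ?T) = a + sum x ?T"
    proof -
      have "sum ?x ?T = sum x ?T" by (rule sum.cong) (use same in auto)
      then show ?thesis using ub(2) fin by simp
    qed
    then have tot: "?h v + S v + sum ?x (insert u ?T) = (y + S v + a) + sum x ?T" using uv by simp
    have "inj_on ?x ?T" using x(1) inj_on_cong[of ?T ?x x] same unfolding sdr_def by blast
    moreover have "?x u \<notin> ?x ` (?T - {u})" using xT(3) same by force
    ultimately have inj: "inj_on ?x (insert u ?T)" unfolding inj_on_insert by blast
    have TB: "insert u ?T \<inter> insert v big = {u}" using ub fin by auto
    have "star_solution (insert v big) v (insert u ?T) X Y S W ?h ?x"
      unfolding star_solution_def TB tot
    proof (intro conjI ballI)
      fix i assume "i \<in> insert u ?T"
      then show "?x i \<in> X i" "?x i \<noteq> ?h v" using xT a uv by auto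
    next
      fix i assume "i \<in> {u}"
      then show "?h i \<in> Y i" "?x i \<noteq> ?h i" "?h i \<noteq> ?h v" "?h i + S i + ?x i \<notin> W i"
        "y + S v + a + sum x ?T \<noteq> ?h i + S i + ?x i"
        using f a uv aW x(2) by auto
    qed (use inj y uv x(2) in auto)
    then show "\<exists>h x. star_solution (insert v big) v (insert u ?T) X Y S W h x" by blast
  qed (use u in auto)
qed

section \<open>Discharging\<close>

text \<open>Discharging takes place on \<open>core\<close>: leaving out the vertices of degree at most 2 costs each of their
  neighbours one unit of degree, which is cheaper than giving them charge. Charges are
  \<open>18 d - 84\<close>, that is \<open>18 (d - 14/3)\<close>, with \<open>d\<close> the degree in the core.\<close>

definition core :: "'a set" where
  "core = {v \<in> V. 3 \<le> degree E v}"

definition demand :: "'a \<Rightarrow> int" where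
  "demand v = (if degree E v = 3 then 10 else if degree E v = 4 then 3 else 0)"

lemma E_nonempty: "E \<noteq> {}"
proof
  assume "E = {}"
  then have "tnsd_colouring V E k (\<lambda>_. 1) (\<lambda>_. 1)"
    using k unfolding tnsd_colouring_def proper_total_colouring_def by simp
  then show False using uncolourable by blast
qed

lemma core_nonempty: "core \<noteq> {}"
proof
  assume c: "core = {}"
  obtain e where e: "e \<in> E" using E_nonempty by auto
  then have "card e = 2" using G unfolding simple_graph_def by auto
  then obtain u v where "e = {v, u}" by (auto simp: card_2_iff)
  then have u: "u \<in> nbrs E v" using e by (simp add: nbrs_def)
  have small: "degree E w \<le> 3" if "w \<in> V" for w using c that unfolding core_def by auto
  have "u \<in> V" "v \<in> V" using u nbrs_facts(2) nbr_in_V by auto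
  then show False using small_nbr_degree[OF u small] small[of v] by auto
qed

lemma nbrs_in_core: "nbrs E v \<inter> core = {u \<in> nbrs E v. 3 \<le> degree E u}"
  using nbrs_facts(2)[of v] unfolding core_def by auto

text \<open>A core neighbour is worth 8, 15 or 18, according to degree 3, 4 or more. The 4-vertices
  are first counted with 18 among the big neighbours and then corrected by 3.\<close>

lemma sum_nbrs_demand:
  "(\<Sum>u\<in>nbrs E v \<inter> core. 18 - demand u) = 8 * int (card {u \<in> nbrs E v. degree E u = 3})
     + 18 * int (card (nbrs E v \<inter> big)) - 3 * int (card {u \<in> nbrs E v. degree E u = 4})"
proof -
  let ?T = "{u \<in> nbrs E v. degree E u = 3}" and ?Q = "{u \<in> nbrs E v. degree E u = 4}"
    and ?R = "{u \<in> nbrs E v. 5 \<le> degree E u}"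
  have fin: "finite ?T" "finite ?Q" "finite ?R" using nbrs_facts(1)[of v] by auto
  have N: "nbrs E v \<inter> core = ?T \<union> (?Q \<union> ?R)" unfolding nbrs_in_core by auto
  have B: "nbrs E v \<inter> big = ?Q \<union> ?R" using nbrs_facts(2)[of v] unfolding big_def by auto
  have cB: "card (nbrs E v \<inter> big) = card ?Q + card ?R" unfolding B using fin by (intro card_Un_disjoint) auto
  have "(\<Sum>u\<in>?T \<union> (?Q \<union> ?R). 18 - demand u) = (\<Sum>u\<in>?T. 18 - demand u) + (\<Sum>u\<in>?Q \<union> ?R. 18 - demand u)"
    using fin by (intro sum.union_disjoint) auto
  also have "(\<Sum>u\<in>?Q \<union> ?R. 18 - demand u) = (\<Sum>u\<in>?Q. 18 - demand u) + (\<Sum>u\<in>?R. 18 - demand u)"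
    using fin by (intro sum.union_disjoint) auto
  also have "(\<Sum>u\<in>?T. 18 - demand u) = (\<Sum>u\<in>?T. 8)" by (intro sum.cong) (auto simp: demand_def)
  also have "(\<Sum>u\<in>?Q. 18 - demand u) = (\<Sum>u\<in>?Q. 15)" by (intro sum.cong) (auto simp: demand_def)
  also have "(\<Sum>u\<in>?R. 18 - demand u) = (\<Sum>u\<in>?R. 18)" by (intro sum.cong) (auto simp: demand_def)
  finally show ?thesis unfolding N cB by simp
qed

text \<open>Two cases are tight: five big neighbours of which two have degree 4,
  \<open>5 * 18 - 2 * 3\<close>, and six 3-vertices with two larger neighbours,
  \<open>6 * 8 + 2 * 18\<close>. Next to a vertex of degree at most 2, the estimate rests on the big
  neighbours alone.\<close>

lemma final_charge_large:
  assumes d: "5 \<le> degree E v"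
  shows "84 \<le> (\<Sum>u\<in>nbrs E v \<inter> core. 18 - demand u)"
proof -
  define t where "t = card (nbrs E v - big)"
  define b where "b = card (nbrs E v \<inter> big)"
  define q where "q = card {u \<in> nbrs E v. degree E u = 4}"
  define t3 where "t3 = card {u \<in> nbrs E v. degree E u = 3}"
  have fin: "finite (nbrs E v)" by (rule nbrs_facts)
  have dd: "degree E v = b + t" unfolding b_def t_def by (rule degree_split)
  have vV: "v \<in> V"
  proof -
    have "nbrs E v \<noteq> {}" using d nbrs_facts(4)[of v] by auto
    then show ?thesis using nbr_in_V by auto
  qed
  have qb: "q \<le> b" unfolding q_def b_def using fin degree_4_big by (intro card_mono) auto
  have q0: "q = 0" if "\<And>u. u \<in> nbrs E v \<Longrightarrow> degree E u = 4 \<Longrightarrow> False"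
  proof -
    have "{u \<in> nbrs E v. degree E u = 4} = {}" using that by blast
    then show ?thesis unfolding q_def by (simp only: card.empty)
  qed
  have Tne: "nbrs E v - big \<noteq> {}" if "1 \<le> t"
    using that unfolding t_def by (metis card.empty not_one_le_zero)
  have d6: "6 \<le> degree E v" if t1: "1 \<le> t"
  proof -
    obtain u where "u \<in> nbrs E v - big" using Tne[OF t1] by auto
    then show ?thesis using small_degree small_nbr_degree by blast
  qed
  have free1: "t + 2 \<le> b" if "1 \<le> t" "degree E v = 7"
    unfolding t_def b_def by (rule free_reduction[OF Tne[OF that(1)], of 1]) (use that k in auto)
  have few: "2 \<le> b" if "1 \<le> t" unfolding b_def by (rule free_reduction_few_big[OF Tne[OF that]])
  \<comment> \<open>Degree 6 leaves two spare colours, as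
    \<open>6 + 3 + 2 = 11 \<le> k\<close>.\<close>
  have fix6: "t * 2 < b" if "1 \<le> t" "degree E v = 6"
    unfolding t_def b_def by (rule fixed_reduction[OF Tne[OF that(1)]]) (use that k in auto)
  have q6: "q = 0" if t: "1 \<le> t" and v6: "degree E v = 6"
  proof (rule q0)
    fix u assume u: "u \<in> nbrs E v" "degree E u = 4"
    obtain w where "w \<in> nbrs E v - big" using Tne[OF t] by auto
    then show False using degree_6_nbrs[OF v6 _ _ u, of w] small_degree[of w v] by auto
  qed
  have "84 \<le> 8 * int t3 + 18 * int b - 3 * int q"
  proof (cases "\<exists>u0\<in>nbrs E v. degree E u0 \<le> 2")
    case True
    then obtain u0 where u0: "u0 \<in> nbrs E v" "degree E u0 \<le> 2" by auto
    then have "u0 \<in> nbrs E v - big" unfolding big_def by auto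
    then have t1: "1 \<le> t" unfolding t_def using fin by (simp add: Suc_le_eq card_gt_0_iff) blast
    have b2: "t + 2 \<le> b" unfolding t_def b_def by (rule free_reduction_2[OF u0])
    consider "degree E v = 6" | "degree E v = 7" | "degree E v = 8" | "9 \<le> degree E v" using d6[OF t1] by linarith
    then show ?thesis
    proof cases
      case 1
      then have "5 \<le> b" using fix6[OF t1] dd by linarith
      then show ?thesis using q6[OF t1 1] by simp
    next
      case 2
      have "t * (1 + 1) < b" unfolding t_def b_def by (rule fixed_reduction_2_bound[OF u0]) (use 2 k in auto)
      then have "2 * t < b" by simp
      then have "b = 5 \<and> t = 2 \<or> 6 \<le> b" using dd 2 by arith
      moreover have "q = 0" if "t = 2"
        by (rule q0) (use degree_7_nbrs[OF 2 _ u0] that in \<open>auto simp: t_def\<close>)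
      ultimately show ?thesis using qb by auto
    next
      case 3
      then have "b = 5 \<and> t = 3 \<or> 6 \<le> b" using dd b2 by arith
      moreover have "q \<le> 2" if "t = 3"
        unfolding q_def by (rule degree_8_nbrs_2[OF 3 _ u0]) (use that in \<open>simp add: t_def\<close>)
      ultimately show ?thesis using qb by auto
    next
      case 4
      then have "6 \<le> b" using dd b2 by arith
      then show ?thesis using qb by linarith
    qed
  next
    case False
    have "nbrs E v - big = {u \<in> nbrs E v. degree E u = 3}"
      using False nbrs_facts(2)[of v] unfolding big_def by force
    then have t3: "t3 = t" unfolding t3_def t_def by simp
    show ?thesis
    proof (cases "t = 0")
      case True
      show ?thesis
      proof (cases "degree E v = 5")
        case v5: True
        have "card {u \<in> nbrs E v. degree E u = 4} \<le> 1"
          using degree_5_nbrs[OF v5] by (intro card_le_Suc0_iff_eq[THEN iffD2, unfolded One_nat_def[symmetric]]) (use fin in auto)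
        then show ?thesis using dd v5 True unfolding q_def[symmetric] by simp
      next
        case False
        then show ?thesis using dd d True qb by linarith
      qed
    next
      case False
      then have t1: "1 \<le> t" by simp
      consider "degree E v = 6" | "degree E v = 7" | "degree E v = 8" | "9 \<le> degree E v" using d6[OF t1] by linarith
      then show ?thesis
      proof cases
        case 1
        then have "5 \<le> b" using fix6[OF t1] dd by linarith
        then show ?thesis using q6[OF t1 1] by simp
      next
        case 2
        then show ?thesis using free1[OF t1] dd t1 t3 qb by linarith
      next
        case 3
        then have "b = 2 \<and> t = 6 \<or> 3 \<le> b" using few[OF t1] dd by arith
        moreover have "q = 0" if "t = 6"
          by (rule q0) (use degree_8_nbrs_3[OF 3] that in \<open>auto simp: t_def\<close>)
        ultimately show ?thesis using dd 3 t3 qb by auto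
      next
        case 4
        then show ?thesis using few[OF t1] dd t3 qb by linarith
      qed
    qed
  qed
  then show ?thesis unfolding sum_nbrs_demand t3_def b_def q_def .
qed

text \<open>Degrees 3 and 4 end with exactly \<open>3 * (18 + 10) = 4 * (18 + 3) = 84\<close>: all
  their neighbours have degree at least 5, hence lie in the core and demand nothing.\<close>

lemma final_charge:
  assumes v: "v \<in> core"
  shows "84 \<le> (\<Sum>u\<in>nbrs E v \<inter> core. 18 + demand v - demand u)"
proof -
  consider "degree E v = 3" | "degree E v = 4" | "5 \<le> degree E v" using v unfolding core_def by fastforce
  then show ?thesis
  proof cases
    case 1
    have n: "6 \<le> degree E u" if "u \<in> nbrs E v" for u
      using small_nbr_degree[of v u] nbrs_sym[of u E v] that 1 by auto
    then have "nbrs E v \<inter> core = nbrs E v" unfolding nbrs_in_core by force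
    moreover have "(\<Sum>u\<in>nbrs E v. 18 + demand v - demand u) = (\<Sum>u\<in>nbrs E v. 28)"
      by (intro sum.cong) (use n 1 in \<open>force simp: demand_def\<close>)+
    ultimately show ?thesis using 1 nbrs_facts(4)[of v] by simp
  next
    case 2
    have n: "5 \<le> degree E u" if "u \<in> nbrs E v" for u
      using nbr_degree_4[of v u] nbrs_sym[of u E v] that 2 by auto
    then have "nbrs E v \<inter> core = nbrs E v" unfolding nbrs_in_core by force
    moreover have "(\<Sum>u\<in>nbrs E v. 18 + demand v - demand u) = (\<Sum>u\<in>nbrs E v. 21)"
      by (intro sum.cong) (use n 2 in \<open>force simp: demand_def\<close>)+
    ultimately show ?thesis using 2 nbrs_facts(4)[of v] by simp
  next
    case 3
    then show ?thesis using final_charge_large[OF 3] by (simp add: demand_def)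
  qed
qed

text \<open>Summed over the core, every demand is paid once and received once, so it cancels, and
  the degrees add up to twice the number of edges. This leaves \<open>84 n \<le> 36 m\<close> for
  \<open>n\<close> vertices and \<open>m\<close> edges.\<close>

lemma dense_core: "7 * card core \<le> 3 * card {e \<in> E. e \<subseteq> core}"
proof -
  let ?E = "{e \<in> E. e \<subseteq> core}"
  have finV: "finite core" using simple_graph_finite(1)[OF G] unfolding core_def by auto
  have finE: "finite ?E" using simple_graph_finite(2)[OF G] by auto
  have G': "simple_graph core ?E" using G finV unfolding simple_graph_def by auto
  have nb: "nbrs ?E v = nbrs E v \<inter> core" if "v \<in> core" for v using that unfolding nbrs_def by auto
  have "(\<Sum>v\<in>core. card {e \<in> ?E. v \<in> e}) = 2 * card ?E"
  proof (rule sum_multicount[OF finV finE], rule ballI)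
    fix e assume e: "e \<in> ?E"
    then have "{v \<in> core. v \<in> e} = e" by auto
    then show "card {v \<in> core. v \<in> e} = 2" using e G unfolding simple_graph_def by auto
  qed
  moreover have "card {e \<in> ?E. v \<in> e} = card (nbrs E v \<inter> core)" if "v \<in> core" for v
    using degree_eq_card_nbrs[OF G', of v] nb[OF that] unfolding degree_def incident_edges_def by simp
  ultimately have hs: "(\<Sum>v\<in>core. card (nbrs E v \<inter> core)) = 2 * card ?E" by simp
  have swap: "(\<Sum>v\<in>core. \<Sum>u\<in>nbrs E v \<inter> core. demand u) = (\<Sum>v\<in>core. \<Sum>u\<in>nbrs E v \<inter> core. demand v)"
  proof -
    have 1: "nbrs E v \<inter> core = {u. u \<in> core \<and> {v, u} \<in> E}" for v unfolding nbrs_def by auto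
    have 2: "nbrs E u \<inter> core = {v. v \<in> core \<and> {v, u} \<in> E}" for u unfolding nbrs_def by (auto simp: insert_commute)
    have "(\<Sum>v\<in>core. \<Sum>u\<in>nbrs E v \<inter> core. demand u) = (\<Sum>u\<in>core. \<Sum>v\<in>{v. v \<in> core \<and> {v, u} \<in> E}. demand u)"
      unfolding 1 using sum.swap_restrict[OF finV finV, of "\<lambda>v u. demand u" "\<lambda>v u. {v, u} \<in> E"] by simp
    then show ?thesis unfolding 2[symmetric] .
  qed
  have "84 * int (card core) = (\<Sum>v\<in>core. 84)" by simp
  also have "\<dots> \<le> (\<Sum>v\<in>core. \<Sum>u\<in>nbrs E v \<inter> core. 18 + demand v - demand u)"
    by (rule sum_mono) (rule final_charge)
  also have "\<dots> = (\<Sum>v\<in>core. \<Sum>u\<in>nbrs E v \<inter> core. 18) + (\<Sum>v\<in>core. \<Sum>u\<in>nbrs E v \<inter> core. demand v)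
      - (\<Sum>v\<in>core. \<Sum>u\<in>nbrs E v \<inter> core. demand u)"
    by (simp only: sum.distrib sum_subtractf)
  also have "\<dots> = 18 * int (\<Sum>v\<in>core. card (nbrs E v \<inter> core))"
    unfolding swap by (simp add: sum_distrib_left mult.commute)
  finally show ?thesis unfolding hs by simp
qed

end

section \<open>From the minimal counterexample to the theorem\<close>

lemma degree_mono: "simple_graph V E \<Longrightarrow> E' \<subseteq> E \<Longrightarrow> degree E' v \<le> degree E v"
  unfolding degree_def using simple_graph_finite(3)[of V E v] by (intro card_mono) (auto simp: incident_edges_def)

text \<open>The last hypothesis is the density bound for induced subgraphs with denominators
  cleared. It passes to edge subsets, as does the degree bound, so a minimal failing edge set
  satisfies the locale and \<open>dense_core\<close> contradicts the density.\<close>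

theorem sparse_graph_tnsd_colouring:
  assumes "simple_graph V E" "11 \<le> k" "\<And>v. v \<in> V \<Longrightarrow> degree E v + 3 \<le> k"
    and "\<And>V'. V' \<subseteq> V \<Longrightarrow> V' \<noteq> {} \<Longrightarrow> 3 * card {e \<in> E. e \<subseteq> V'} < 7 * card V'"
  shows "\<exists>f g. tnsd_colouring V E k f g"
proof -
  have "finite E" using simple_graph_finite(2)[OF assms(1)] .
  then show ?thesis using assms
  proof (induction E rule: finite_psubset_induct)
    case (psubset E)
    show ?case
    proof (rule ccontr)
      assume un: "\<not> (\<exists>f g. tnsd_colouring V E k f g)"
      have "\<exists>f g. tnsd_colouring V E' k f g" if E': "E' \<subset> E" for E'
      proof (rule psubset.IH[OF E'])
        show "simple_graph V E'" using simple_graph_subset[OF psubset.prems(1)] E' by blast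
        show "11 \<le> k" by (rule psubset.prems)
        show "degree E' v + 3 \<le> k" if "v \<in> V" for v
          using degree_mono[OF psubset.prems(1), of E' v] psubset.prems(3)[OF that] E' by auto
        show "3 * card {e \<in> E'. e \<subseteq> V'} < 7 * card V'" if "V' \<subseteq> V" "V' \<noteq> {}" for V'
        proof -
          have "card {e \<in> E'. e \<subseteq> V'} \<le> card {e \<in> E. e \<subseteq> V'}"
            using psubset.hyps(1) E' by (intro card_mono) auto
          then show ?thesis using psubset.prems(4)[OF that] by linarith
        qed
      qed
      then interpret minimal_counterexample V E k
        using psubset.prems(1-3) un by unfold_locales
      have "core \<subseteq> V" unfolding core_def by auto
      then show False using psubset.prems(4)[OF _ core_nonempty] dense_core by force
    qed
  qed
qed

theorem theorem5:
  fixes V :: "'a set" and E :: "'a set set"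
  assumes "simple_graph V E"
    and "max_degree V E \<ge> 8"
    and "mad V E < 14 / 3"
  shows "tnsd_index V E \<le> max_degree V E + 3"
proof -
  have fin: "finite V" "finite E" using simple_graph_finite[OF assms(1)] by auto
  have "\<exists>f g. tnsd_colouring V E (max_degree V E + 3) f g"
  proof (rule sparse_graph_tnsd_colouring[OF assms(1)])
    show "11 \<le> max_degree V E + 3" using assms(2) by simp
    show "degree E v + 3 \<le> max_degree V E + 3" if "v \<in> V" for v
      using that fin unfolding max_degree_def by auto
    show "3 * card {e \<in> E. e \<subseteq> V'} < 7 * card V'" if V': "V' \<subseteq> V" "V' \<noteq> {}" for V'
    proof -
      let ?r = "\<lambda>(V', E'). 2 * real (card E') / real (card V')"
      let ?D = "{2 * real (card E') / real (card V') | V' E'.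
        V' \<subseteq> V \<and> V' \<noteq> {} \<and> E' \<subseteq> E \<and> (\<forall>e\<in>E'. e \<subseteq> V')}"
      \<comment> \<open>\<open>Max\<close> bounds the members of a finite set only; the densities
        come from finitely many pairs of subsets.\<close>
      have "?D \<subseteq> ?r ` (Pow V \<times> Pow E)" by auto
      then have "finite ?D" using fin finite_subset by blast
      moreover have "2 * real (card {e \<in> E. e \<subseteq> V'}) / real (card V') \<in> ?D" using V' by blast
      ultimately have "2 * real (card {e \<in> E. e \<subseteq> V'}) / real (card V') \<le> mad V E"
        unfolding mad_def by (intro Max_ge) auto
      then have "2 * real (card {e \<in> E. e \<subseteq> V'}) / real (card V') < 14 / 3" using assms(3) by linarith
      moreover have "0 < card V'" using V' fin by (simp add: card_gt_0_iff finite_subset)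
      ultimately have "3 * real (card {e \<in> E. e \<subseteq> V'}) < 7 * real (card V')" by (simp add: field_simps)
      then show ?thesis by linarith
    qed
  qed
  then show ?thesis unfolding tnsd_index_def by (rule Least_le)
qed

end
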